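(* Let $g\ge2$, let $J_1\le J_2\le\Gamma_g$ and let $f\colon J_1\backslash\widetilde{\Sigma_g}\to J_2\backslash\widetilde{\Sigma_g}$ be the natural morphism. Then: (1) $f$ restricts to a morphism $\mathrm{Core}(J_1)\to\mathrm{Core}(J_2)$; and (2) for $1\ne\gamma\in J_1$, every shortest representative cycle of the conjugacy class $\gamma^{J_2}$ in $\mathrm{Core}(J_2)$ is an $f$-image of a shortest representative cycle of $\gamma^{J_1}$ in $\mathrm{Core}(J_1)$.
   Context: Fix $g\ge2$ and let $R=[a_1,b_1]\cdots[a_g,b_g]$. $\Sigma_g$ is the closed connected orientable surface of genus $g$ with the CW-structure obtained from a $4g$-gon by gluing its edges according to $R$: one vertex $o$, $2g$ oriented edges labeled $a_1,b_1,\dots,a_g,b_g$, one 2-cell. $\Gamma_g=\pi_1(\Sigma_g,o)=\langle a_1,b_1,\dots,a_g,b_g\mid R\rangle$; $\widetilde{\Sigma_g}$ is the universal cover with its $\Gamma_g$-action. Every covering space of $\Sigma_g$ inherits a CW-structure and directions and labels of edges. A morphism between subcomplexes of covering spaces of $\Sigma_g$ is a map of CW-complexes mapping $i$-cells to $i$-cells and respecting directions and labels of edges. The natural morphism $f$ is the quotient map induced by the identity of $\widetilde{\Sigma_g}$. For $J\le\Gamma_g$ let $\Upsilon=J\backslash\widetilde{\Sigma_g}$ be the corresponding covering space of $\Sigma_g$. Conjugacy classes $\gamma^J$ in $J$ correspond to free-homotopy classes of oriented closed curves in $\Upsilon$; a shortest representative cycle of $\gamma^J$ is a cycle in the 1-skeleton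 $\Upsilon^{(1)}$ representing this class with the minimal number of edges. The core surface $\mathrm{Core}(J)$ is the subcomplex of $\Upsilon$ obtained by (i) taking the union of all shortest-representative cycles in $\Upsilon^{(1)}$ of every free-homotopy class of essential (not null-homotopic) closed curves in $\Upsilon$, and (ii) adding every connected component of the complement which contains finitely many 2-cells. For completeness, the core surface of the trivial subgroup is defined to be the 0-dimensional complex consisting of a single vertex mapped to $o$. *)

theory Defs
  imports "HOL-Algebra.Group"
begin

section \<open>Combinatorial 2-complexes\<close>

text \<open>
  A CW-complex of dimension at most two whose 2-cells are polygons is recorded by its sets of
  cells, the end points of its directed edges, the attaching word of each 2-cell (the closed
  edge-path read along the polygon from its base corner) and the labels of its edges.
  An oriented edge is a pair \<open>(e, s)\<close>; \<open>s = True\<close> means that \<open>e\<close> is traversed along its direction.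
\<close>

type_synonym 'e oedge = "'e \<times> bool"

record ('v, 'e, 'f, 'l) complex2 =
  verts :: "'v set"
  edges :: "'e set"
  faces :: "'f set"
  src :: "'e \<Rightarrow> 'v"
  tgt :: "'e \<Rightarrow> 'v"
  bnd :: "'f \<Rightarrow> 'e oedge list"
  lab :: "'e \<Rightarrow> 'l"

definition origin :: "('v, 'e, 'f, 'l) complex2 \<Rightarrow> 'e oedge \<Rightarrow> 'v" where
  "origin X d = (if snd d then src X (fst d) else tgt X (fst d))"

definition terminus :: "('v, 'e, 'f, 'l) complex2 \<Rightarrow> 'e oedge \<Rightarrow> 'v" where
  "terminus X d = (if snd d then tgt X (fst d) else src X (fst d))"

definition flip :: "'e oedge \<Rightarrow> 'e oedge" where
  "flip d = (fst d, \<not> snd d)"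

text \<open>An edge-path is given by its first vertex and its oriented edges, so that constant paths
  \<open>(v, [])\<close> are included.\<close>

type_synonym ('v, 'e) epath = "'v \<times> 'e oedge list"

fun walk :: "('v, 'e, 'f, 'l) complex2 \<Rightarrow> 'v \<Rightarrow> 'e oedge list \<Rightarrow> 'v \<Rightarrow> bool" where
  "walk X v [] w \<longleftrightarrow> v \<in> verts X \<and> v = w"
| "walk X v (d # ds) w \<longleftrightarrow>
     v \<in> verts X \<and> fst d \<in> edges X \<and> origin X d = v \<and> walk X (terminus X d) ds w"

definition is_path :: "('v, 'e, 'f, 'l) complex2 \<Rightarrow> ('v, 'e) epath \<Rightarrow> bool" where
  "is_path X p \<longleftrightarrow> (\<exists>w. walk X (fst p) (snd p) w)"

definition is_cycle :: "('v, 'e, 'f, 'l) complex2 \<Rightarrow> ('v, 'e) epath \<Rightarrow> bool" where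
  "is_cycle X p \<longleftrightarrow> walk X (fst p) (snd p) (fst p)"

definition path_length :: "('v, 'e) epath \<Rightarrow> nat" where
  "path_length p = length (snd p)"

definition is_complex :: "('v, 'e, 'f, 'l) complex2 \<Rightarrow> bool" where
  "is_complex X \<longleftrightarrow>
     (\<forall>e \<in> edges X. src X e \<in> verts X \<and> tgt X e \<in> verts X) \<and>
     (\<forall>\<phi> \<in> faces X. bnd X \<phi> \<noteq> [] \<and> is_cycle X (origin X (hd (bnd X \<phi>)), bnd X \<phi>))"


section \<open>Morphisms and subcomplexes\<close>

type_synonym ('v, 'e, 'f, 'v2, 'e2, 'f2) cmap = "('v \<Rightarrow> 'v2) \<times> ('e \<Rightarrow> 'e2) \<times> ('f \<Rightarrow> 'f2)"

definition morphism ::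
  "('v, 'e, 'f, 'l) complex2 \<Rightarrow> ('v2, 'e2, 'f2, 'l) complex2 \<Rightarrow>
   ('v, 'e, 'f, 'v2, 'e2, 'f2) cmap \<Rightarrow> bool" where
  "morphism X Y f \<longleftrightarrow> (case f of (fv, fe, ff) \<Rightarrow>
     is_complex X \<and> is_complex Y \<and>
     fv ` verts X \<subseteq> verts Y \<and> fe ` edges X \<subseteq> edges Y \<and> ff ` faces X \<subseteq> faces Y \<and>
     (\<forall>e \<in> edges X. src Y (fe e) = fv (src X e) \<and> tgt Y (fe e) = fv (tgt X e) \<and>
                    lab Y (fe e) = lab X e) \<and>
     (\<forall>\<phi> \<in> faces X. bnd Y (ff \<phi>) = map (map_prod fe id) (bnd X \<phi>)))"

definition map_path ::
  "('v, 'e, 'f, 'v2, 'e2, 'f2) cmap \<Rightarrow> ('v, 'e) epath \<Rightarrow> ('v2, 'e2) epath" where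
  "map_path f p = (case f of (fv, fe, ff) \<Rightarrow> (fv (fst p), map (map_prod fe id) (snd p)))"

datatype ('v, 'e, 'f) cell = Vert 'v | Edge 'e | Face 'f

definition cells :: "('v, 'e, 'f, 'l) complex2 \<Rightarrow> ('v, 'e, 'f) cell set" where
  "cells X = Vert ` verts X \<union> Edge ` edges X \<union> Face ` faces X"

text \<open>A subcomplex is given by its set of cells.\<close>

definition subcomplex ::
  "('v, 'e, 'f, 'l) complex2 \<Rightarrow> ('v, 'e, 'f) cell set \<Rightarrow> ('v, 'e, 'f, 'l) complex2" where
  "subcomplex X S = X\<lparr>verts := {v \<in> verts X. Vert v \<in> S},
                      edges := {e \<in> edges X. Edge e \<in> S},
                      faces := {\<phi> \<in> faces X. Face \<phi> \<in> S}\<rparr>"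

definition path_cells ::
  "('v, 'e, 'f, 'l) complex2 \<Rightarrow> ('v, 'e) epath \<Rightarrow> ('v, 'e, 'f) cell set" where
  "path_cells X p =
     {Vert (fst p)} \<union> (\<Union>d \<in> set (snd p). {Edge (fst d), Vert (origin X d), Vert (terminus X d)})"


section \<open>Homotopy of edge-paths and free homotopy of cycles\<close>

text \<open>
  Cellular homotopy relative to the end points: insertion and deletion of a backtrack
  or of the attaching word of a 2-cell. (Cyclic rotations and inverses of attaching words can be
  inserted by combining these moves.)
\<close>

inductive hstep ::
  "('v, 'e, 'f, 'l) complex2 \<Rightarrow> ('v, 'e) epath \<Rightarrow> ('v, 'e) epath \<Rightarrow> bool" for X where
  backtrack: "is_path X (v, xs @ ys) \<Longrightarrow> is_path X (v, xs @ [d, flip d] @ ys) \<Longrightarrow>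
     hstep X (v, xs @ ys) (v, xs @ [d, flip d] @ ys)"
| face: "is_path X (v, xs @ ys) \<Longrightarrow> \<phi> \<in> faces X \<Longrightarrow> is_path X (v, xs @ bnd X \<phi> @ ys) \<Longrightarrow>
     hstep X (v, xs @ ys) (v, xs @ bnd X \<phi> @ ys)"

definition homotopic ::
  "('v, 'e, 'f, 'l) complex2 \<Rightarrow> ('v, 'e) epath \<Rightarrow> ('v, 'e) epath \<Rightarrow> bool" where
  "homotopic X = equivclp (hstep X)"

text \<open>For free homotopy the base point of a cycle may also be moved along the cycle.\<close>

inductive fhstep ::
  "('v, 'e, 'f, 'l) complex2 \<Rightarrow> ('v, 'e) epath \<Rightarrow> ('v, 'e) epath \<Rightarrow> bool" for X where
  based: "is_cycle X p \<Longrightarrow> hstep X p q \<Longrightarrow> fhstep X p q"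
| rotate: "is_cycle X (origin X d, d # ds) \<Longrightarrow>
     fhstep X (origin X d, d # ds) (terminus X d, ds @ [d])"

definition freely_homotopic ::
  "('v, 'e, 'f, 'l) complex2 \<Rightarrow> ('v, 'e) epath \<Rightarrow> ('v, 'e) epath \<Rightarrow> bool" where
  "freely_homotopic X = equivclp (fhstep X)"

definition essential :: "('v, 'e, 'f, 'l) complex2 \<Rightarrow> ('v, 'e) epath \<Rightarrow> bool" where
  "essential X p \<longleftrightarrow> is_cycle X p \<and> \<not> (\<exists>v \<in> verts X. freely_homotopic X p (v, []))"

definition hclass ::
  "('v, 'e, 'f, 'l) complex2 \<Rightarrow> ('v, 'e) epath \<Rightarrow> ('v, 'e) epath set" where
  "hclass X p = {q. homotopic X p q}"


section \<open>Fundamental group, universal cover and quotients\<close>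

text \<open>Product of homotopy classes, induced by concatenation (the union is over homotopic paths,
  so it is a single class). It multiplies elements of the fundamental group, and is also the
  left action of the fundamental group on the vertices of the universal cover.\<close>

definition cmult ::
  "('v, 'e, 'f, 'l) complex2 \<Rightarrow> ('v, 'e) epath set \<Rightarrow> ('v, 'e) epath set \<Rightarrow> ('v, 'e) epath set"
  where
  "cmult X c c' = (\<Union>p \<in> c. \<Union>q \<in> c'. hclass X (fst p, snd p @ snd q))"

definition pi1 :: "('v, 'e, 'f, 'l) complex2 \<Rightarrow> 'v \<Rightarrow> ('v, 'e) epath set monoid" where
  "pi1 X x0 = \<lparr>carrier = {hclass X p | p. is_cycle X p \<and> fst p = x0},
               mult = cmult X, one = hclass X (x0, [])\<rparr>"

definition extend ::
  "('v, 'e, 'f, 'l) complex2 \<Rightarrow> ('v, 'e) epath set \<Rightarrow> 'e oedge \<Rightarrow> ('v, 'e) epath set" where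
  "extend X c d = (\<Union>p \<in> c. hclass X (fst p, snd p @ [d]))"

fun lift ::
  "('v, 'e, 'f, 'l) complex2 \<Rightarrow> ('v, 'e) epath set \<Rightarrow> 'e oedge list \<Rightarrow>
   (('v, 'e) epath set \<times> 'e) oedge list" where
  "lift X c [] = []"
| "lift X c (d # ds) =
     ((if snd d then c else extend X c d, fst d), snd d) # lift X (extend X c d) ds"

text \<open>
  The universal cover of a connected complex, in its usual construction: the vertices are the
  homotopy classes of paths starting at the base point \<open>x0\<close>; the edge \<open>(c, e)\<close> is the lift of \<open>e\<close>
  that starts at the vertex \<open>c\<close>, and the face \<open>(c, \<phi>)\<close> is the lift of \<open>\<phi>\<close> whose base corner is \<open>c\<close>.
\<close>

definition ucover ::
  "('v, 'e, 'f, 'l) complex2 \<Rightarrow> 'v \<Rightarrow>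
   (('v, 'e) epath set, ('v, 'e) epath set \<times> 'e, ('v, 'e) epath set \<times> 'f, 'l) complex2" where
  "ucover X x0 = \<lparr>
     verts = {hclass X p | p. is_path X p \<and> fst p = x0},
     edges = {(hclass X p, e) | p e. fst p = x0 \<and> is_path X p \<and> e \<in> edges X \<and>
                is_path X (fst p, snd p @ [(e, True)])},
     faces = {(hclass X p, \<phi>) | p \<phi>. fst p = x0 \<and> is_path X p \<and> \<phi> \<in> faces X \<and>
                is_path X (fst p, snd p @ bnd X \<phi>)},
     src = (\<lambda>(c, e). c),
     tgt = (\<lambda>(c, e). extend X c (e, True)),
     bnd = (\<lambda>(c, \<phi>). lift X c (bnd X \<phi>)),
     lab = (\<lambda>(c, e). lab X e)\<rparr>"

definition vorbit ::
  "('v, 'e, 'f, 'l) complex2 \<Rightarrow> ('v, 'e) epath set set \<Rightarrow> ('v, 'e) epath set \<Rightarrow>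
   ('v, 'e) epath set set" where
  "vorbit X J c = (\<lambda>\<gamma>. cmult X \<gamma> c) ` J"

text \<open>Orbits of edges and of faces of the universal cover.\<close>

definition corbit ::
  "('v, 'e, 'f, 'l) complex2 \<Rightarrow> ('v, 'e) epath set set \<Rightarrow> ('v, 'e) epath set \<times> 'a \<Rightarrow>
   (('v, 'e) epath set \<times> 'a) set" where
  "corbit X J x = (\<lambda>\<gamma>. (cmult X \<gamma> (fst x), snd x)) ` J"

text \<open>
  The quotient of the universal cover by a subgroup \<open>J\<close> of the fundamental group. Its cells are
  the \<open>J\<close>-orbits of cells. As end points, attaching words and labels are equivariant,
  the image of an orbit of edges under \<^const>\<open>src\<close> or \<^const>\<open>tgt\<close> is an orbit of vertices, and the
  arguments of \<^const>\<open>the_elem\<close> are singletons.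
\<close>

definition quotient_cover ::
  "('v, 'e, 'f, 'l) complex2 \<Rightarrow> 'v \<Rightarrow> ('v, 'e) epath set set \<Rightarrow>
   (('v, 'e) epath set set, (('v, 'e) epath set \<times> 'e) set, (('v, 'e) epath set \<times> 'f) set, 'l)
     complex2" where
  "quotient_cover X x0 J = (let U = ucover X x0 in \<lparr>
     verts = vorbit X J ` verts U,
     edges = corbit X J ` edges U,
     faces = corbit X J ` faces U,
     src = (\<lambda>E. src U ` E),
     tgt = (\<lambda>E. tgt U ` E),
     bnd = (\<lambda>F. the_elem ((\<lambda>\<phi>. map (map_prod (corbit X J) id) (bnd U \<phi>)) ` F)),
     lab = (\<lambda>E. the_elem (lab U ` E))\<rparr>)"

definition projection ::
  "('v, 'e, 'f, 'l) complex2 \<Rightarrow> ('v, 'e) epath set set \<Rightarrow>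
   (('v, 'e) epath set, ('v, 'e) epath set \<times> 'e, ('v, 'e) epath set \<times> 'f,
    ('v, 'e) epath set set, (('v, 'e) epath set \<times> 'e) set, (('v, 'e) epath set \<times> 'f) set) cmap"
  where
  "projection X J = (vorbit X J, corbit X J, corbit X J)"

text \<open>For \<open>J1 \<le> J2\<close>, the map from the quotient by \<open>J1\<close> to the quotient by \<open>J2\<close> that is induced by
  the identity: a \<open>J1\<close>-orbit is sent to the \<open>J2\<close>-orbit containing it.\<close>

definition natural_map ::
  "('v, 'e, 'f, 'l) complex2 \<Rightarrow> ('v, 'e) epath set set \<Rightarrow>
   (('v, 'e) epath set set, (('v, 'e) epath set \<times> 'e) set, (('v, 'e) epath set \<times> 'f) set,
    ('v, 'e) epath set set, (('v, 'e) epath set \<times> 'e) set, (('v, 'e) epath set \<times> 'f) set) cmap"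
  where
  "natural_map X J2 =
     ((\<lambda>V. \<Union> (vorbit X J2 ` V)), (\<lambda>E. \<Union> (corbit X J2 ` E)), (\<lambda>F. \<Union> (corbit X J2 ` F)))"


section \<open>Shortest representatives and the core\<close>

definition conj_class :: "('a, 'b) monoid_scheme \<Rightarrow> 'a set \<Rightarrow> 'a \<Rightarrow> 'a set" where
  "conj_class G J \<gamma> = {h \<otimes>\<^bsub>G\<^esub> \<gamma> \<otimes>\<^bsub>G\<^esub> inv\<^bsub>G\<^esub> h | h. h \<in> J}"

text \<open>
  The free homotopy class attached to a conjugacy class \<open>K\<close> of \<open>J\<close> is that of the
  projection of a path of the universal cover from its base point \<open>v0\<close> to \<open>\<gamma> v0\<close>, for \<open>\<gamma> \<in> K\<close>.
\<close>

definition represents ::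
  "('v, 'e, 'f, 'l) complex2 \<Rightarrow> 'v \<Rightarrow> ('v, 'e) epath set set \<Rightarrow> ('v, 'e) epath set set \<Rightarrow>
   (('v, 'e) epath set set, (('v, 'e) epath set \<times> 'e) set) epath \<Rightarrow> bool" where
  "represents X x0 J K z \<longleftrightarrow>
     is_cycle (quotient_cover X x0 J) z \<and>
     (\<exists>\<gamma> \<in> K. \<exists>p. let v0 = hclass X (x0, []) in
        fst p = v0 \<and> walk (ucover X x0) v0 (snd p) (cmult X \<gamma> v0) \<and>
        freely_homotopic (quotient_cover X x0 J) z (map_path (projection X J) p))"

definition shortest_rep ::
  "('v, 'e, 'f, 'l) complex2 \<Rightarrow> 'v \<Rightarrow> ('v, 'e) epath set set \<Rightarrow> ('v, 'e) epath set set \<Rightarrow>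
   (('v, 'e) epath set set, (('v, 'e) epath set \<times> 'e) set) epath \<Rightarrow> bool" where
  "shortest_rep X x0 J K z \<longleftrightarrow> represents X x0 J K z \<and>
     (\<forall>z'. represents X x0 J K z' \<longrightarrow> path_length z \<le> path_length z')"

text \<open>The union of the shortest cycles in all free homotopy classes of essential closed curves.
  (Every closed curve is freely homotopic to a cycle in the 1-skeleton.)\<close>

definition core_skeleton :: "('v, 'e, 'f, 'l) complex2 \<Rightarrow> ('v, 'e, 'f) cell set" where
  "core_skeleton X = \<Union> {path_cells X z | z. essential X z \<and>
     (\<forall>z'. is_cycle X z' \<and> freely_homotopic X z z' \<longrightarrow> path_length z \<le> path_length z')}"

fun boundary_cells :: "('v, 'e, 'f, 'l) complex2 \<Rightarrow> ('v, 'e, 'f) cell \<Rightarrow> ('v, 'e, 'f) cell set"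
  where
  "boundary_cells X (Vert v) = {}"
| "boundary_cells X (Edge e) = {Vert (src X e), Vert (tgt X e)}"
| "boundary_cells X (Face \<phi>) =
     (\<Union>d \<in> set (bnd X \<phi>). {Edge (fst d), Vert (origin X d), Vert (terminus X d)})"

text \<open>
  The complement of a subcomplex is a disjoint union of open cells, and its connected components
  are the unions of the classes of the equivalence relation generated by
  \<open>\<sigma>\<close> lying in the boundary of \<open>\<tau>\<close>. A component is given by its set of open cells.
\<close>

definition compl_adj ::
  "('v, 'e, 'f, 'l) complex2 \<Rightarrow> ('v, 'e, 'f) cell set \<Rightarrow>
   ('v, 'e, 'f) cell \<Rightarrow> ('v, 'e, 'f) cell \<Rightarrow> bool" where
  "compl_adj X S \<sigma> \<tau> \<longleftrightarrow> \<sigma> \<in> cells X - S \<and> \<tau> \<in> cells X - S \<and>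
     (\<sigma> \<in> boundary_cells X \<tau> \<or> \<tau> \<in> boundary_cells X \<sigma>)"

definition compl_components ::
  "('v, 'e, 'f, 'l) complex2 \<Rightarrow> ('v, 'e, 'f) cell set \<Rightarrow> ('v, 'e, 'f) cell set set" where
  "compl_components X S = {{\<tau>. (compl_adj X S)\<^sup>*\<^sup>* \<sigma> \<tau>} | \<sigma>. \<sigma> \<in> cells X - S}"

definition core_cells :: "('v, 'e, 'f, 'l) complex2 \<Rightarrow> ('v, 'e, 'f) cell set" where
  "core_cells X = core_skeleton X \<union>
     \<Union> {C \<in> compl_components X (core_skeleton X). finite {\<phi>. Face \<phi> \<in> C}}"


section \<open>The surface of genus \<open>g\<close>\<close>

datatype gen = GenA nat | GenB nat

definition surface :: "nat \<Rightarrow> (unit, gen, unit, gen) complex2" where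
  "surface g = \<lparr>
     verts = {()}, edges = GenA ` {1..g} \<union> GenB ` {1..g}, faces = {()},
     src = (\<lambda>_. ()), tgt = (\<lambda>_. ()),
     bnd = (\<lambda>_. concat (map (\<lambda>i. [(GenA i, True), (GenB i, True), (GenA i, False), (GenB i, False)])
                            [1..<Suc g])),
     lab = (\<lambda>e. e)\<rparr>"

type_synonym surf_elt = "(unit, gen) epath set"
type_synonym surf_vert = "surf_elt set"
type_synonym surf_edge = "(surf_elt \<times> gen) set"
type_synonym surf_face = "(surf_elt \<times> unit) set"

definition surface_group :: "nat \<Rightarrow> surf_elt monoid" where
  "surface_group g = pi1 (surface g) ()"

definition cover :: "nat \<Rightarrow> surf_elt set \<Rightarrow> (surf_vert, surf_edge, surf_face, gen) complex2" where
  "cover g J = quotient_cover (surface g) () J"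

definition natural_morphism ::
  "nat \<Rightarrow> surf_elt set \<Rightarrow>
   (surf_vert, surf_edge, surf_face, surf_vert, surf_edge, surf_face) cmap" where
  "natural_morphism g J2 = natural_map (surface g) J2"

text \<open>
  \<open>is_core g J C\<close>: the subcomplex with cells \<open>C\<close> is a core surface of \<open>J\<close>. For nontrivial \<open>J\<close> there is
  exactly one. The core surface of the trivial group is a single vertex that does not have a
  preferred position in the universal cover, and every vertex is allowed.
\<close>

definition is_core :: "nat \<Rightarrow> surf_elt set \<Rightarrow> (surf_vert, surf_edge, surf_face) cell set \<Rightarrow> bool" where
  "is_core g J C \<longleftrightarrow>
     (if J = {\<one>\<^bsub>surface_group g\<^esub>} then \<exists>v \<in> verts (cover g J). C = {Vert v}
      else C = core_cells (cover g J))"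

definition shortest_cycle_of ::
  "nat \<Rightarrow> surf_elt set \<Rightarrow> surf_elt \<Rightarrow> (surf_vert, surf_edge) epath \<Rightarrow> bool" where
  "shortest_cycle_of g J \<gamma> z \<longleftrightarrow>
     shortest_rep (surface g) () J (conj_class (surface_group g) J \<gamma>) z"

end

theory Submission
  imports Defs
begin

text \<open>
  Let \<open>U\<close> be the universal cover, and \<open>Q1\<close> and \<open>Q2\<close> its quotients by \<open>J1\<close> and \<open>J2\<close>. The natural
  morphism \<open>f\<close> from \<open>Q1\<close> to \<open>Q2\<close> is a covering, and both claims follow from lifting along it. This argument applies to the quotients
  of the universal cover of any 2-complex, and the surface is an instance.

  Free homotopies of cycles lift along a covering, step by step, and the lift of the last cycle
  has the same number of edges as the cycle itself (\<open>freely_homotopic_lift\<close>). Hence the image of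
  an essential cycle is essential, and the image of a shortest cycle of its free homotopy class is
  shortest as well: a homotopy to a constant or to a shorter cycle would lift. So \<open>f\<close> maps the
  skeleton of the first core into the skeleton of the second (\<open>core_skeleton_map\<close>).

  Now let a cell lie in a component \<open>C\<close> of the complement of the first skeleton which has finitely
  many faces, and suppose that its image is not in the second skeleton. Chains of incident cells lift
  along coverings, and a lift of a chain in the complement of the second skeleton avoids the first
  one. So the component of the image is covered by cells of \<open>C\<close> and has finitely many faces
  (\<open>core_cells_map\<close>). This gives the first claim when \<open>J1\<close> is not trivial. For trivial \<open>J1\<close> one
  only has to know that the second core has a vertex, which can then be lifted to a vertex of \<open>U\<close>
  (\<open>core_vertex\<close>, \<open>vertex_morphism\<close>).

  For the second claim take a path in \<open>U\<close> from the base point to its translate by \<open>\<gamma>\<close>. Its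
  projections to \<open>Q1\<close> and \<open>Q2\<close> represent the conjugacy classes of \<open>\<gamma>\<close>
  (\<open>represents_iff\<close>), and \<open>f\<close> maps the first projection to the second. A free homotopy from the
  second projection to a given shortest cycle lifts to one that starts at the first projection. It
  ends at a cycle over the given one, and this cycle is shortest because \<open>f\<close> preserves lengths
  (\<open>shortest_rep_lift\<close>).
\<close>

section \<open>Walks and elementary homotopies\<close>

definition rpath :: "'e oedge list \<Rightarrow> 'e oedge list" where
  "rpath ds = rev (map flip ds)"

lemma flip_flip [simp]: "flip (flip d) = d"
  and fst_flip [simp]: "fst (flip d) = fst d"
  and origin_flip [simp]: "origin X (flip d) = terminus X d"
  and terminus_flip [simp]: "terminus X (flip d) = origin X d"
  by (auto simp: flip_def origin_def terminus_def)

lemma rpath_rpath [simp]: "rpath (rpath ds) = ds"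
  by (simp add: rpath_def rev_map comp_def)

lemma walk_startD: "walk X v ds w \<Longrightarrow> v \<in> verts X"
  by (cases ds) auto

lemma walk_endD: "walk X v ds w \<Longrightarrow> w \<in> verts X"
  by (induction ds arbitrary: v) auto

lemma walk_append: "walk X v (xs @ ys) w \<longleftrightarrow> (\<exists>u. walk X v xs u \<and> walk X u ys w)"
  by (induction xs arbitrary: v) (auto dest: walk_startD)

lemma walk_det: "walk X v ds w \<Longrightarrow> walk X v ds w' \<Longrightarrow> w = w'"
  by (induction ds arbitrary: v) auto

lemma walk_append_from: "walk X v xs u \<Longrightarrow> walk X v (xs @ ys) w \<longleftrightarrow> walk X u ys w"
  unfolding walk_append by (metis walk_det)

lemma walk_edges: "walk X v ds w \<Longrightarrow> d \<in> set ds \<Longrightarrow> fst d \<in> edges X"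
  by (induction ds arbitrary: v) auto

lemma edge_ends:
  assumes "is_complex X" "fst d \<in> edges X"
  shows "origin X d \<in> verts X" "terminus X d \<in> verts X"
  using assms by (auto simp: is_complex_def origin_def terminus_def)

lemma walk_rpath:
  assumes "is_complex X" "walk X v ds w"
  shows "walk X w (rpath ds) v"
  using assms(2)
proof (induction ds arbitrary: v)
  case Nil
  then show ?case by (auto simp: rpath_def)
next
  case (Cons d ds)
  then have "walk X w (rpath ds) (terminus X d)" "fst d \<in> edges X" "origin X d = v" "v \<in> verts X"
    by auto
  then show ?case
    using edge_ends[OF assms(1)] by (auto simp: rpath_def walk_append)
qed

lemma face_walk:
  assumes "is_complex X" "\<phi> \<in> faces X"
  shows "walk X (origin X (hd (bnd X \<phi>))) (bnd X \<phi>) (origin X (hd (bnd X \<phi>)))" "bnd X \<phi> \<noteq> []"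
  using assms by (auto simp: is_complex_def is_cycle_def)

lemma walk_hd: "walk X v ds w \<Longrightarrow> ds \<noteq> [] \<Longrightarrow> origin X (hd ds) = v"
  by (cases ds) auto

lemma walk_last: "walk X v ds w \<Longrightarrow> ds \<noteq> [] \<Longrightarrow> \<exists>d \<in> set ds. terminus X d = w"
  by (induction ds arbitrary: v) fastforce+

text \<open>The two kinds of loops that a homotopy step inserts or deletes behave alike under
  coverings, and are treated together.\<close>

definition elementary :: "('v, 'e, 'f, 'l) complex2 \<Rightarrow> 'e oedge list \<Rightarrow> bool" where
  "elementary X ds \<longleftrightarrow> (\<exists>d. ds = [d, flip d]) \<or> (\<exists>\<phi> \<in> faces X. ds = bnd X \<phi>)"

lemma elementary_backtrack [simp]: "elementary X [d, flip d]"
  and elementary_face [simp]: "\<phi> \<in> faces X \<Longrightarrow> elementary X (bnd X \<phi>)"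
  unfolding elementary_def by blast+

lemma elementary_closed:
  assumes "is_complex X" "elementary X ds" "walk X a ds b"
  shows "b = a"
  using assms(2) unfolding elementary_def
proof
  assume "\<exists>d. ds = [d, flip d]"
  then show ?thesis using assms(3) by auto
next
  assume "\<exists>\<phi> \<in> faces X. ds = bnd X \<phi>"
  then obtain \<phi> where "\<phi> \<in> faces X" "ds = bnd X \<phi>" by blast
  then show ?thesis
    using face_walk[OF assms(1)] walk_hd[OF assms(3)] walk_det[OF assms(3)] by metis
qed

text \<open>Since an inserted loop is closed, a homotopy step does not move the part of the path
  behind it. This form of the steps, with all intermediate vertices named, is the one that lifts.\<close>
lemma hstep_iff:
  assumes "is_complex X"
  shows "hstep X p q \<longleftrightarrow> (\<exists>v xs ms ys a w. p = (v, xs @ ys) \<and> q = (v, xs @ ms @ ys) \<and>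
    elementary X ms \<and> walk X v xs a \<and> walk X a ms a \<and> walk X a ys w)" (is "_ \<longleftrightarrow> ?R")
proof
  have *: ?R if "p = (v, xs @ ys)" "q = (v, xs @ ms @ ys)" "elementary X ms"
    "is_path X (v, xs @ ys)" "is_path X (v, xs @ ms @ ys)" for v xs ms ys
  proof -
    from that(5) obtain a b w where w: "walk X v xs a" "walk X a ms b" "walk X b ys w"
      by (auto simp: is_path_def walk_append)
    with elementary_closed[OF assms that(3)] that show ?R by blast
  qed
  assume "hstep X p q"
  then show ?R
  proof cases
    case (backtrack v xs ys d)
    then show ?thesis by (intro *[of v xs ys "[d, flip d]"]) auto
  next
    case (face v xs ys \<phi>)
    then show ?thesis by (intro *[of v xs ys "bnd X \<phi>"]) auto
  qed
next
  assume ?R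
  then obtain v xs ms ys a w where *: "p = (v, xs @ ys)" "q = (v, xs @ ms @ ys)"
    "elementary X ms" "walk X v xs a" "walk X a ms a" "walk X a ys w" by blast
  then have P: "is_path X (v, xs @ ys)" "is_path X (v, xs @ ms @ ys)"
    by (auto simp: is_path_def walk_append)
  show "hstep X p q"
    using *(3) P hstep.backtrack[of X v xs ys] hstep.face[of X v xs ys]
    by (auto simp: *(1,2) elementary_def)
qed

lemma hstepI:
  assumes "is_complex X" "elementary X ms" "walk X v xs a" "walk X a ms a" "walk X a ys w"
  shows "hstep X (v, xs @ ys) (v, xs @ ms @ ys)"
  unfolding hstep_iff[OF assms(1)] using assms(2-) by blast

lemma hstepE:
  assumes "is_complex X" "hstep X p q"
  obtains v xs ms ys a w where "p = (v, xs @ ys)" "q = (v, xs @ ms @ ys)" "elementary X ms"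
    "walk X v xs a" "walk X a ms a" "walk X a ys w"
  using assms(2) unfolding hstep_iff[OF assms(1)] by blast

lemma homotopic_refl [simp]: "homotopic X p p"
  and homotopic_sym: "homotopic X p q \<Longrightarrow> homotopic X q p"
  and homotopic_trans [trans]: "homotopic X p q \<Longrightarrow> homotopic X q r \<Longrightarrow> homotopic X p r"
  unfolding homotopic_def by (auto intro: equivclp_sym equivclp_trans)

lemma freely_homotopic_refl [simp]: "freely_homotopic X p p"
  and freely_homotopic_sym: "freely_homotopic X p q \<Longrightarrow> freely_homotopic X q p"
  and freely_homotopic_trans [trans]:
    "freely_homotopic X p q \<Longrightarrow> freely_homotopic X q r \<Longrightarrow> freely_homotopic X p r"
  unfolding freely_homotopic_def by (auto intro: equivclp_sym equivclp_trans)

lemma hstep_homotopic: "hstep X p q \<Longrightarrow> homotopic X p q"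
  unfolding homotopic_def by (rule r_into_equivclp)

lemma fhstep_freely_homotopic: "fhstep X p q \<Longrightarrow> freely_homotopic X p q"
  unfolding freely_homotopic_def by (rule r_into_equivclp)

lemma hstep_ends:
  assumes "is_complex X" "hstep X p q"
  shows "fst p = fst q" "walk X (fst p) (snd p) w \<longleftrightarrow> walk X (fst q) (snd q) w"
proof -
  obtain v xs ms ys a where *: "p = (v, xs @ ys)" "q = (v, xs @ ms @ ys)"
    "walk X v xs a" "walk X a ms a"
    using hstepE[OF assms] by metis
  then show "fst p = fst q" by simp
  show "walk X (fst p) (snd p) w \<longleftrightarrow> walk X (fst q) (snd q) w"
    using *(1,2) walk_append_from[OF *(3)] walk_append_from[OF *(4)] by simp
qed

lemma homotopic_ends:
  assumes "is_complex X" "homotopic X p q"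
  shows "fst p = fst q \<and> (walk X (fst p) (snd p) w \<longleftrightarrow> walk X (fst q) (snd q) w)"
  using assms(2) unfolding homotopic_def
proof (induction rule: equivclp_induct)
  case (step y z)
  then show ?case using hstep_ends[OF assms(1)] by metis
qed simp

text \<open>Homotopy is a congruence for concatenation. Together with the cancellation of
  \<open>ds @ rpath ds\<close> this makes the homotopy classes of loops a group.\<close>
lemma homotopic_append:
  assumes X: "is_complex X" and h: "homotopic X p q"
    and w: "walk X v us (fst p)" "walk X (fst p) (snd p) b" "walk X b vs w"
  shows "homotopic X (v, us @ snd p @ vs) (v, us @ snd q @ vs)"
  using h unfolding homotopic_def
proof (induction rule: equivclp_induct)
  case (step y z)
  have y: "fst p = fst y" "walk X (fst y) (snd y) b" and z: "fst p = fst z" "walk X (fst z) (snd z) b"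
    using homotopic_ends[OF X, of p y b] homotopic_ends[OF X, of p z b] step.hyps w(2)
      equivclp_into_equivclp[OF step.hyps]
    unfolding homotopic_def by auto
  have *: "hstep X (v, us @ snd y @ vs) (v, us @ snd z @ vs)"
    if yz: "hstep X y z" and y: "fst p = fst y" "walk X (fst y) (snd y) b" for y z
  proof -
    obtain v' xs ms ys a c where *: "y = (v', xs @ ys)" "z = (v', xs @ ms @ ys)" "elementary X ms"
      "walk X v' xs a" "walk X a ms a" "walk X a ys c"
      using hstepE[OF X yz] by metis
    have "c = b" using y(2) * walk_det[of X v' "xs @ ys"] by (auto simp: walk_append)
    then show ?thesis
      using * w y(1) hstepI[OF X *(3), of v "us @ xs" a "ys @ vs" w]
      by (auto simp: walk_append)
  qed
  from step.hyps(2) have "equivclp (hstep X) (v, us @ snd y @ vs) (v, us @ snd z @ vs)"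
    using *[of y z] *[of z y] y z by (metis equivclp_sym r_into_equivclp)
  with step.IH show ?case by (rule equivclp_trans)
qed simp

lemma homotopic_rpath:
  assumes X: "is_complex X" and "walk X v ds w"
  shows "homotopic X (v, ds @ rpath ds) (v, [])"
  using assms(2)
proof (induction ds arbitrary: v)
  case Nil
  then show ?case by (simp add: rpath_def)
next
  case (Cons d ds)
  then have w: "walk X (terminus X d) ds w" and d: "fst d \<in> edges X" "origin X d = v"
    by auto
  have w': "walk X (terminus X d) (ds @ rpath ds) (terminus X d)"
    using w walk_rpath[OF X w] by (auto simp: walk_append)
  have "homotopic X (v, [d] @ (ds @ rpath ds) @ [flip d]) (v, [d] @ [] @ [flip d])"
    using homotopic_append[OF X Cons.IH[OF w], of v "[d]" "terminus X d" "[flip d]" v] d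
      edge_ends[OF X, of d] w' by auto
  also have "homotopic X (v, [d] @ [] @ [flip d]) (v, [])"
    using hstepI[OF X elementary_backtrack, of v "[]" v d "[]" v] d edge_ends[OF X, of d]
    by (auto intro!: homotopic_sym[OF hstep_homotopic])
  finally show ?case by (simp add: rpath_def)
qed

lemma fhstep_cycle:
  assumes "is_complex X" "fhstep X p q"
  shows "is_cycle X p \<and> is_cycle X q"
  using assms(2)
proof (cases)
  case based
  then show ?thesis
    using hstep_ends[OF assms(1)] unfolding is_cycle_def by metis
next
  case (rotate d ds)
  then show ?thesis
    using edge_ends[OF assms(1), of d]
    by (auto simp: is_cycle_def walk_append)
qed

lemma freely_homotopic_cycle:
  assumes "is_complex X" "freely_homotopic X p q"
  shows "is_cycle X p \<longleftrightarrow> is_cycle X q"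
  using assms(2) unfolding freely_homotopic_def
  by (induction rule: equivclp_induct) (use fhstep_cycle[OF assms(1)] in blast)+

lemma homotopic_freely_homotopic:
  assumes X: "is_complex X" and "homotopic X p q" "is_cycle X p"
  shows "freely_homotopic X p q"
  using assms(2) unfolding homotopic_def
proof (induction rule: equivclp_induct)
  case (step y z)
  have "homotopic X p y" "homotopic X p z"
    using step.hyps equivclp_into_equivclp[OF step.hyps] by (auto simp: homotopic_def)
  then have "is_cycle X y" "is_cycle X z"
    using homotopic_ends[OF X] assms(3) unfolding is_cycle_def by metis+
  then have "freely_homotopic X y z"
    using step.hyps(2) fhstep.based fhstep_freely_homotopic freely_homotopic_sym by metis
  with step.IH show ?case by (rule freely_homotopic_trans)
qed simp

lemma freely_homotopic_rotate:
  assumes X: "is_complex X" and "walk X a xs b" "walk X b ys a"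
  shows "freely_homotopic X (a, xs @ ys) (b, ys @ xs)"
  using assms(2,3)
proof (induction xs arbitrary: a ys)
  case (Cons d xs)
  then have w: "walk X (terminus X d) xs b" and d: "fst d \<in> edges X" "origin X d = a" "a \<in> verts X"
    by auto
  have "freely_homotopic X (a, (d # xs) @ ys) (terminus X d, xs @ (ys @ [d]))"
    using fhstep.rotate[of X d "xs @ ys"] Cons.prems d
    by (auto intro!: fhstep_freely_homotopic simp: is_cycle_def walk_append)
  also have "freely_homotopic X (terminus X d, xs @ (ys @ [d])) (b, (ys @ [d]) @ xs)"
    using Cons.prems(2) d edge_ends[OF X, of d] by (intro Cons.IH[OF w]) (auto simp: walk_append)
  finally show ?case by simp
qed auto

text \<open>Conjugate loops are freely homotopic: rotating the tail to the end makes it adjacent to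
  its inverse. This is why a free homotopy class only remembers a conjugacy class.\<close>
lemma freely_homotopic_conjugate:
  assumes X: "is_complex X" and "walk X a rs b" "walk X b qs b"
  shows "freely_homotopic X (a, rs @ qs @ rpath rs) (b, qs)"
proof -
  note r = walk_rpath[OF X assms(2)]
  have "freely_homotopic X (a, rs @ qs @ rpath rs) (b, (qs @ rpath rs) @ rs)"
    using freely_homotopic_rotate[OF X assms(2), of "qs @ rpath rs"] r assms(3)
    by (auto simp: walk_append)
  also have "freely_homotopic X (b, (qs @ rpath rs) @ rs) (b, qs)"
  proof -
    have "homotopic X (b, qs @ rpath rs @ rs) (b, qs @ [])"
      using homotopic_append[OF X homotopic_rpath[OF X r], of b qs b "[]" b] assms r walk_endD
      by (fastforce simp: walk_append)
    then show ?thesis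
      using assms r by (intro homotopic_freely_homotopic[OF X]) (auto simp: is_cycle_def walk_append)
  qed
  finally show ?thesis .
qed


section \<open>Coverings and the lifting of free homotopies\<close>

definition omap :: "('e \<Rightarrow> 'e2) \<Rightarrow> 'e oedge \<Rightarrow> 'e2 oedge" where
  "omap h d = (h (fst d), snd d)"

lemma map_prod_omap: "map_prod h id = omap h"
  by (auto simp: omap_def)

lemma map_omap_rpath: "map (omap h) (rpath ds) = rpath (map (omap h) ds)"
  by (simp add: rpath_def rev_map comp_def omap_def flip_def)

lemma fst_omap [simp]: "fst (omap h d) = h (fst d)"
  and snd_omap [simp]: "snd (omap h d) = snd d"
  and omap_flip: "omap h (flip d) = flip (omap h d)"
  by (auto simp: omap_def flip_def)

text \<open>Every oriented edge lifts uniquely to each vertex over its origin. Of faces only the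
  existence of a lift with prescribed base corner is postulated, since the boundary of the lift
  is determined by the unique lifting of edges.\<close>
locale covering =
  fixes X :: "('v, 'e, 'f, 'l) complex2" and Y :: "('v2, 'e2, 'f2, 'l) complex2"
    and fv :: "'v \<Rightarrow> 'v2" and fe :: "'e \<Rightarrow> 'e2" and ff :: "'f \<Rightarrow> 'f2"
  assumes morphism: "morphism X Y (fv, fe, ff)"
    and edge_lift: "\<And>v d. \<lbrakk>v \<in> verts X; fst d \<in> edges Y; origin Y d = fv v\<rbrakk> \<Longrightarrow>
      \<exists>d'. fst d' \<in> edges X \<and> origin X d' = v \<and> omap fe d' = d"
    and edge_inj: "\<And>d d'. \<lbrakk>fst d \<in> edges X; fst d' \<in> edges X; origin X d = origin X d';
      omap fe d = omap fe d'\<rbrakk> \<Longrightarrow> d = d'"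
    and face_lift: "\<And>v \<phi>. \<lbrakk>v \<in> verts X; \<phi> \<in> faces Y; origin Y (hd (bnd Y \<phi>)) = fv v\<rbrakk> \<Longrightarrow>
      \<exists>\<phi>' \<in> faces X. ff \<phi>' = \<phi> \<and> origin X (hd (bnd X \<phi>')) = v"
begin

abbreviation "oe \<equiv> omap fe"
abbreviation "mp \<equiv> map_path (fv, fe, ff)"

lemma complex: "is_complex X" "is_complex Y"
  using morphism by (auto simp: morphism_def)

lemma mp_simps [simp]: "mp (v, ds) = (fv v, map oe ds)" "fst (mp p) = fv (fst p)"
  "snd (mp p) = map oe (snd p)" "path_length (mp p) = path_length p"
  by (auto simp: map_path_def path_length_def map_prod_omap)

lemma map_cells:
  "v \<in> verts X \<Longrightarrow> fv v \<in> verts Y" "e \<in> edges X \<Longrightarrow> fe e \<in> edges Y" "\<phi> \<in> faces X \<Longrightarrow> ff \<phi> \<in> faces Y"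
  using morphism by (auto simp: morphism_def)

lemma map_bnd: "\<phi> \<in> faces X \<Longrightarrow> bnd Y (ff \<phi>) = map oe (bnd X \<phi>)"
  using morphism by (auto simp: morphism_def map_prod_omap)

lemma map_ends:
  assumes "fst d \<in> edges X"
  shows "origin Y (oe d) = fv (origin X d)" "terminus Y (oe d) = fv (terminus X d)"
  using morphism assms by (cases d; auto simp: morphism_def origin_def terminus_def)+

lemma walk_map: "walk X v ds w \<Longrightarrow> walk Y (fv v) (map oe ds) (fv w)"
  by (induction ds arbitrary: v) (auto simp: map_cells map_ends)

lemma walk_lift:
  assumes "v \<in> verts X" "walk Y (fv v) ds u"
  shows "\<exists>ds' w. walk X v ds' w \<and> map oe ds' = ds \<and> fv w = u"
  using assms
proof (induction ds arbitrary: v)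
  case Nil
  then show ?case by (intro exI[of _ "[]"] exI[of _ v]) auto
next
  case (Cons d ds)
  then obtain d' where d': "fst d' \<in> edges X" "origin X d' = v" "oe d' = d"
    using edge_lift[of v d] by auto
  moreover obtain ds' w where "walk X (terminus X d') ds' w" "map oe ds' = ds" "fv w = u"
    using Cons.IH[of "terminus X d'"] Cons.prems d' map_ends[of d'] edge_ends[OF complex(1) d'(1)]
    by auto
  ultimately show ?case using Cons.prems(1) by (intro exI[of _ "d' # ds'"] exI[of _ w]) auto
qed

lemma walk_lift_unique:
  assumes "walk X v ds w" "walk X v ds' w'" "map oe ds = map oe ds'"
  shows "ds = ds' \<and> w = w'"
  using assms
proof (induction ds arbitrary: v ds')
  case (Cons d ds)
  then obtain d' es where [simp]: "ds' = d' # es" by (cases ds') auto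
  have "d = d'" using Cons.prems edge_inj[of d d'] by auto
  then show ?case using Cons.IH[of "terminus X d" es] Cons.prems by auto
qed auto

lemma elementary_map: "elementary X ds \<Longrightarrow> elementary Y (map oe ds)"
  unfolding elementary_def using map_bnd map_cells(3) by (fastforce simp: omap_flip)

text \<open>A backtrack lifts to a backtrack, and the boundary of a face lifts to the boundary of a
  lifted face. So elementary loops lift to closed walks, and therefore homotopies lift.\<close>
lemma elementary_lift:
  assumes "elementary Y ms" "a \<in> verts X" "walk Y (fv a) ms (fv a)"
  shows "\<exists>ms'. elementary X ms' \<and> walk X a ms' a \<and> map oe ms' = ms"
  using assms(1)[unfolded elementary_def]
proof
  assume "\<exists>d. ms = [d, flip d]"
  then obtain d where d: "ms = [d, flip d]" by blast
  then obtain d' where d': "fst d' \<in> edges X" "origin X d' = a" "oe d' = d"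
    using edge_lift[of a d] assms by auto
  then show ?thesis
    using assms(2) d edge_ends[OF complex(1) d'(1)]
    by (intro exI[of _ "[d', flip d']"]) (auto simp: omap_flip simp del: split_paired_Ex)
next
  assume "\<exists>\<phi> \<in> faces Y. ms = bnd Y \<phi>"
  then obtain \<phi> where \<phi>: "\<phi> \<in> faces Y" "ms = bnd Y \<phi>" by blast
  moreover have "origin Y (hd (bnd Y \<phi>)) = fv a"
    using walk_hd[OF assms(3)] face_walk[OF complex(2) \<phi>(1)] \<phi>(2) by auto
  ultimately obtain \<phi>' where "\<phi>' \<in> faces X" "ff \<phi>' = \<phi>" "origin X (hd (bnd X \<phi>')) = a"
    using face_lift assms(2) by blast
  then show ?thesis
    using face_walk[OF complex(1)] map_bnd \<phi> unfolding elementary_def by metis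
qed

lemma hstep_map:
  assumes "hstep X p q"
  shows "hstep Y (mp p) (mp q)"
proof -
  obtain v xs ms ys a w where *: "p = (v, xs @ ys)" "q = (v, xs @ ms @ ys)" "elementary X ms"
    "walk X v xs a" "walk X a ms a" "walk X a ys w"
    using assms unfolding hstep_iff[OF complex(1)] by blast
  then show ?thesis
    using hstepI[OF complex(2) elementary_map walk_map walk_map walk_map] by simp
qed

lemma hstep_lift:
  assumes "is_path X p" "hstep Y (mp p) q"
  shows "\<exists>q'. hstep X p q' \<and> mp q' = q"
proof -
  obtain v xs ms ys a w where *: "mp p = (v, xs @ ys)" "q = (v, xs @ ms @ ys)" "elementary Y ms"
    "walk Y v xs a" "walk Y a ms a"
    using assms(2) unfolding hstep_iff[OF complex(2)] by blast
  obtain xs' ys' v' where p: "p = (v', xs' @ ys')" "map oe xs' = xs" "map oe ys' = ys" "fv v' = v"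
    using *(1) by (cases p) (auto simp: map_eq_append_conv)
  obtain a' w' where w': "walk X v' xs' a'" "walk X a' ys' w'"
    using assms(1) p by (auto simp: is_path_def walk_append)
  have a: "a = fv a'" using walk_map[OF w'(1)] *(4) p walk_det by metis
  obtain ms' where "elementary X ms'" "walk X a' ms' a'" "map oe ms' = ms"
    using elementary_lift[OF *(3), of a'] *(5) a walk_endD[OF w'(1)] by auto
  then show ?thesis
    using p *(2) hstepI[OF complex(1) _ w'(1) _ w'(2)]
    by (intro exI[of _ "(v', xs' @ ms' @ ys')"]) auto
qed

text \<open>The loop that is deleted below also closes up above, because its lift is unique.\<close>
lemma hstep_lift_back:
  assumes "is_path X p" "hstep Y q (mp p)"
  shows "\<exists>q'. hstep X q' p \<and> mp q' = q"
proof -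
  obtain v xs ms ys a w where *: "q = (v, xs @ ys)" "mp p = (v, xs @ ms @ ys)" "elementary Y ms"
    "walk Y v xs a" "walk Y a ms a"
    using assms(2) unfolding hstep_iff[OF complex(2)] by blast
  obtain xs' ys' ms' v' where p: "p = (v', xs' @ ms' @ ys')" "map oe xs' = xs" "map oe ys' = ys"
    "map oe ms' = ms" "fv v' = v"
    using *(2) by (cases p) (fastforce simp: map_eq_append_conv append_eq_map_conv)
  obtain a' b' w' where w': "walk X v' xs' a'" "walk X a' ms' b'" "walk X b' ys' w'"
    using assms(1) p by (auto simp: is_path_def walk_append)
  have a: "a = fv a'" using walk_map[OF w'(1)] *(4) p walk_det by metis
  obtain ns where "elementary X ns" "walk X a' ns a'" "map oe ns = ms"
    using elementary_lift[OF *(3), of a'] *(5) a walk_endD[OF w'(1)] by auto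
  \<comment> \<open>The segment of \<open>p\<close> over \<open>ms\<close> is a lift of \<open>ms\<close>, so it is the closed lift \<open>ns\<close>.\<close>
  with walk_lift_unique[OF w'(2)] p have "elementary X ms'" "walk X a' ms' a'" "b' = a'"
    by auto
  then show ?thesis
    using p *(1) hstepI[OF complex(1) _ w'(1)] w'(3)
    by (intro exI[of _ "(v', xs' @ ys')"]) auto
qed

lemma homotopic_lift:
  assumes "homotopic Y r q" "r = mp p" "is_path X p"
  shows "\<exists>q'. homotopic X p q' \<and> mp q' = q"
  using assms(1) unfolding homotopic_def
proof (induction rule: equivclp_induct)
  case base
  then show ?case using assms by (intro exI[of _ p]) simp
next
  case (step y z)
  then obtain y' where y': "equivclp (hstep X) p y'" "mp y' = y" by blast
  then have "is_path X y'"
    using homotopic_ends[OF complex(1), of p y'] assms(3) unfolding is_path_def homotopic_def by blast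
  then obtain z' where "hstep X y' z' \<or> hstep X z' y'" "mp z' = z"
    using step.hyps(2) y'(2) hstep_lift hstep_lift_back by metis
  then show ?case using y'(1) by (blast intro: equivclp_into_equivclp)
qed

lemma is_cycle_map: "is_cycle X p \<Longrightarrow> is_cycle Y (mp p)"
  using walk_map by (fastforce simp: is_cycle_def)

lemma freely_homotopic_map:
  assumes "freely_homotopic X p q"
  shows "freely_homotopic Y (mp p) (mp q)"
  using assms unfolding freely_homotopic_def
proof (induction rule: equivclp_induct)
  case (step y z)
  have *: "fhstep Y (mp y) (mp z)" if "fhstep X y z" for y z
    using that
  proof cases
    case based
    then show ?thesis using is_cycle_map hstep_map fhstep.based by blast
  next
    case (rotate d ds)
    then have "fst d \<in> edges X" by (auto simp: is_cycle_def)
    then show ?thesis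
      using fhstep.rotate[of Y "oe d" "map oe ds"] is_cycle_map[OF rotate(3)] rotate
      by (simp add: map_ends)
  qed
  then have "fhstep Y (mp y) (mp z) \<or> fhstep Y (mp z) (mp y)" using step.hyps(2) by blast
  with step.IH show ?case by (rule equivclp_into_equivclp)
qed simp

lemma fhstep_lift:
  assumes "is_cycle X p" "fhstep Y (mp p) q"
  shows "\<exists>q'. fhstep X p q' \<and> mp q' = q"
  using assms(2)
proof cases
  case based
  have "is_path X p" using assms(1) by (auto simp: is_path_def is_cycle_def)
  then show ?thesis using hstep_lift based assms(1) fhstep.based by blast
next
  case (rotate d ds)
  then obtain v' d' ds' where p: "p = (v', d' # ds')" "oe d' = d" "map oe ds' = ds"
    by (cases p) auto
  then have d': "fst d' \<in> edges X" "origin X d' = v'" using assms(1) by (auto simp: is_cycle_def)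
  then show ?thesis
    using fhstep.rotate[of X d' ds'] assms(1) p rotate map_ends[OF d'(1)]
    by (intro exI[of _ "(terminus X d', ds' @ [d'])"]) auto
qed

lemma fhstep_lift_back:
  assumes "is_cycle X p" "fhstep Y q (mp p)"
  shows "\<exists>q'. fhstep X q' p \<and> mp q' = q"
  using assms(2)
proof cases
  case based
  have "is_path X p" using assms(1) by (auto simp: is_path_def is_cycle_def)
  then obtain q' where "hstep X q' p" "mp q' = q" using hstep_lift_back based by blast
  moreover have "is_cycle X q'"
    using hstep_ends[OF complex(1) \<open>hstep X q' p\<close>] assms(1) by (simp add: is_cycle_def)
  ultimately show ?thesis using fhstep.based by blast
next
  case (rotate d ds)
  then obtain v' d' ds' where p: "p = (v', ds' @ [d'])" "oe d' = d" "map oe ds' = ds"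
    by (cases p) (auto simp: map_eq_append_conv)
  then have d': "fst d' \<in> edges X" "terminus X d' = v'" "walk X v' ds' (origin X d')"
    using assms(1) by (auto simp: is_cycle_def walk_append)
  then have "is_cycle X (origin X d', d' # ds')"
    using edge_ends[OF complex(1) d'(1)] by (auto simp: is_cycle_def)
  then show ?thesis
    using fhstep.rotate[of X d' ds'] p rotate d' map_ends[OF d'(1)]
    by (intro exI[of _ "(origin X d', d' # ds')"]) auto
qed

text \<open>The central lifting property. The path of cycles is prescribed by the homotopy below; only the
  cycle above its start is given.\<close>
lemma freely_homotopic_lift:
  assumes "freely_homotopic Y r q" "r = mp p" "is_cycle X p"
  shows "\<exists>q'. freely_homotopic X p q' \<and> is_cycle X q' \<and> mp q' = q"
  using assms(1) unfolding freely_homotopic_def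
proof (induction rule: equivclp_induct)
  case base
  then show ?case using assms by (intro exI[of _ p]) simp
next
  case (step y z)
  then obtain y' where y': "equivclp (fhstep X) p y'" "is_cycle X y'" "mp y' = y" by blast
  then obtain z' where "fhstep X y' z' \<or> fhstep X z' y'" "mp z' = z"
    using step.hyps(2) fhstep_lift fhstep_lift_back by metis
  then show ?case using y'(1) fhstep_cycle[OF complex(1)]
    by (blast intro: equivclp_into_equivclp)
qed

end


section \<open>Cores of coverings\<close>

lemma boundary_cells_cells:
  assumes X: "is_complex X" and "\<tau> \<in> cells X"
  shows "boundary_cells X \<tau> \<subseteq> cells X"
proof (cases \<tau>)
  case (Edge e)
  then have "e \<in> edges X" using assms(2) by (auto simp: cells_def)
  then show ?thesis using X Edge by (auto simp: is_complex_def cells_def)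
next
  case (Face \<phi>)
  then have \<phi>: "\<phi> \<in> faces X" using assms(2) by (auto simp: cells_def)
  have "fst d \<in> edges X" if "d \<in> set (bnd X \<phi>)" for d
    using walk_edges[OF face_walk(1)[OF X \<phi>] that] .
  then show ?thesis using edge_ends[OF X] Face by (fastforce simp: cells_def)
qed simp

lemma boundary_edge_ends:
  "boundary_cells X (Edge (fst d)) = {Vert (origin X d), Vert (terminus X d)}"
  by (auto simp: origin_def terminus_def)

lemma path_cells_closed:
  "\<sigma> \<in> path_cells X p \<Longrightarrow> boundary_cells X \<sigma> \<subseteq> path_cells X p"
  unfolding path_cells_def using boundary_edge_ends[of X] by fastforce

lemma walk_subcomplex:
  assumes "walk X v ds w" "Vert w \<in> S" "\<And>d. d \<in> set ds \<Longrightarrow> {Edge (fst d), Vert (origin X d)} \<subseteq> S"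
  shows "walk (subcomplex X S) v ds w"
  using assms
  by (induction ds arbitrary: v) (auto simp: subcomplex_def origin_def terminus_def)

lemma subcomplex_complex:
  assumes X: "is_complex X" and S: "\<And>\<sigma>. \<sigma> \<in> S \<Longrightarrow> boundary_cells X \<sigma> \<subseteq> S"
  shows "is_complex (subcomplex X S)"
proof -
  have "bnd X \<phi> \<noteq> [] \<and> is_cycle (subcomplex X S) (origin X (hd (bnd X \<phi>)), bnd X \<phi>)"
    if \<phi>: "\<phi> \<in> faces X" "Face \<phi> \<in> S" for \<phi>
  proof -
    have "{Edge (fst d), Vert (origin X d)} \<subseteq> S" if "d \<in> set (bnd X \<phi>)" for d
      using S[OF \<phi>(2)] that by fastforce
    then show ?thesis
      using face_walk[OF X \<phi>(1)] walk_subcomplex[OF face_walk(1)[OF X \<phi>(1)], of S]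
      by (simp add: is_cycle_def)
  qed
  moreover have "origin (subcomplex X S) = origin X"
    by (auto simp: origin_def subcomplex_def fun_eq_iff)
  moreover have "src X e \<in> verts X \<and> tgt X e \<in> verts X \<and> Vert (src X e) \<in> S \<and> Vert (tgt X e) \<in> S"
    if "e \<in> edges X" "Edge e \<in> S" for e
    using X S[OF that(2)] that(1) by (auto simp: is_complex_def)
  ultimately show ?thesis
    unfolding is_complex_def by (simp add: subcomplex_def)
qed

text \<open>The core is closed because a component of the complement can only be left through its
  boundary, which lies in the skeleton.\<close>

lemma core_cells_closed:
  assumes X: "is_complex X" and "\<sigma> \<in> core_cells X"
  shows "boundary_cells X \<sigma> \<subseteq> core_cells X"
proof (cases "\<sigma> \<in> core_skeleton X")
  case True
  then obtain z where z: "\<sigma> \<in> path_cells X z" "path_cells X z \<subseteq> core_skeleton X"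
    unfolding core_skeleton_def by blast
  have "boundary_cells X \<sigma> \<subseteq> core_skeleton X"
    using path_cells_closed[OF z(1)] z(2) by (rule order_trans)
  then show ?thesis unfolding core_cells_def by blast
next
  case False
  then obtain \<sigma>0 where \<sigma>0: "\<sigma>0 \<in> cells X - core_skeleton X"
    "(compl_adj X (core_skeleton X))\<^sup>*\<^sup>* \<sigma>0 \<sigma>"
    "finite {\<phi>. Face \<phi> \<in> {\<tau>. (compl_adj X (core_skeleton X))\<^sup>*\<^sup>* \<sigma>0 \<tau>}}"
    using assms(2) by (auto simp: core_cells_def compl_components_def)
  show ?thesis
  proof
    fix \<rho> assume \<rho>: "\<rho> \<in> boundary_cells X \<sigma>"
    have \<sigma>: "\<sigma> \<in> cells X - core_skeleton X"
      using \<sigma>0(2,1) by (cases rule: rtranclp.cases) (auto simp: compl_adj_def)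
    show "\<rho> \<in> core_cells X"
    proof (cases "\<rho> \<in> core_skeleton X")
      case True
      then show ?thesis by (simp add: core_cells_def)
    next
      case False
      then have "compl_adj X (core_skeleton X) \<sigma> \<rho>"
        using \<rho> \<sigma> boundary_cells_cells[OF X, of \<sigma>] by (auto simp: compl_adj_def)
      with \<sigma>0(2) have "(compl_adj X (core_skeleton X))\<^sup>*\<^sup>* \<sigma>0 \<rho>" by simp
      then show ?thesis using \<sigma>0(1,3) unfolding core_cells_def compl_components_def by blast
    qed
  qed
qed

context covering
begin

abbreviation "mc \<equiv> map_cell fv fe ff"

lemma mc_cells: "\<sigma> \<in> cells X \<Longrightarrow> mc \<sigma> \<in> cells Y"
  using map_cells by (auto simp: cells_def)

lemma mc_path_cells:
  assumes "is_path X p"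
  shows "path_cells Y (mp p) = mc ` path_cells X p"
proof -
  obtain w where w: "walk X (fst p) (snd p) w" using assms by (auto simp: is_path_def)
  have "{Edge (fst (oe d)), Vert (origin Y (oe d)), Vert (terminus Y (oe d))} =
      mc ` {Edge (fst d), Vert (origin X d), Vert (terminus X d)}" if "d \<in> set (snd p)" for d
    using walk_edges[OF w that] by (simp add: map_ends)
  then show ?thesis by (simp add: path_cells_def image_UN)
qed

lemma mc_boundary:
  assumes "\<sigma> \<in> cells X"
  shows "boundary_cells Y (mc \<sigma>) = mc ` boundary_cells X \<sigma>"
proof (cases \<sigma>)
  case (Edge e)
  then have "e \<in> edges X" using assms by (auto simp: cells_def)
  then show ?thesis using Edge morphism by (auto simp: morphism_def)
next
  case (Face \<phi>)
  then have \<phi>: "\<phi> \<in> faces X" using assms by (auto simp: cells_def)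
  have "{Edge (fst (oe d)), Vert (origin Y (oe d)), Vert (terminus Y (oe d))} =
      mc ` {Edge (fst d), Vert (origin X d), Vert (terminus X d)}" if "d \<in> set (bnd X \<phi>)" for d
    using walk_edges[OF face_walk(1)[OF complex(1) \<phi>] that] by (simp add: map_ends)
  then show ?thesis using Face by (simp add: map_bnd[OF \<phi>] image_UN)
qed simp

text \<open>A homotopy of the image of an essential cycle to a constant or to a shorter cycle would lift.\<close>

lemma essential_map:
  assumes "essential X z"
  shows "essential Y (mp z)"
  unfolding essential_def
proof (intro conjI notI)
  show "is_cycle Y (mp z)" using assms is_cycle_map by (auto simp: essential_def)
  assume "\<exists>v \<in> verts Y. freely_homotopic Y (mp z) (v, [])"
  then obtain v where "freely_homotopic Y (mp z) (v, [])" by blast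
  then obtain q where q: "freely_homotopic X z q" "is_cycle X q" "mp q = (v, [])"
    using freely_homotopic_lift assms unfolding essential_def by blast
  then have "q = (fst q, [])" "fst q \<in> verts X" by (cases q; auto simp: is_cycle_def)+
  with q(1) assms show False unfolding essential_def by metis
qed

text \<open>A cycle which is shortest above stays shortest below, because a shorter competitor would
  lift to a competitor of the same length above.\<close>
lemma core_skeleton_map:
  assumes "\<sigma> \<in> core_skeleton X"
  shows "mc \<sigma> \<in> core_skeleton Y"
proof -
  obtain z where z: "essential X z" "\<sigma> \<in> path_cells X z"
    "\<And>z'. is_cycle X z' \<Longrightarrow> freely_homotopic X z z' \<Longrightarrow> path_length z \<le> path_length z'"
    using assms by (auto simp: core_skeleton_def)
  have c: "is_cycle X z" and p: "is_path X z"
    using z(1) by (auto simp: essential_def is_cycle_def is_path_def)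
  have "path_length (mp z) \<le> path_length z'" if h: "freely_homotopic Y (mp z) z'" for z'
    using freely_homotopic_lift[OF h refl c] z(3) mp_simps(4) by metis
  moreover have "mc \<sigma> \<in> path_cells Y (mp z)" using z(2) mc_path_cells[OF p] by simp
  ultimately show ?thesis
    unfolding core_skeleton_def using essential_map[OF z(1)] by blast
qed

text \<open>Lifts a face so that a given vertex of its boundary walk, and not just its base corner,
  becomes \<open>u\<close>: walk back from \<open>u\<close> along the lifted initial segment \<open>as\<close> to find the base corner.\<close>
lemma face_lift_at:
  assumes u: "u \<in> verts X" and \<phi>: "\<phi> \<in> faces Y" "bnd Y \<phi> = as @ bs"
    and w: "walk Y (origin Y (hd (bnd Y \<phi>))) as (fv u)"
  obtains \<phi>' as' bs' v where "\<phi>' \<in> faces X" "ff \<phi>' = \<phi>" "bnd X \<phi>' = as' @ bs'"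
    "map oe as' = as" "map oe bs' = bs" "walk X v as' u" "walk X u bs' v"
proof -
  obtain rs v where rs: "walk X u rs v" "map oe rs = rpath as" "fv v = origin Y (hd (bnd Y \<phi>))"
    using walk_lift[OF u walk_rpath[OF complex(2) w]] by blast
  obtain \<phi>' where \<phi>': "\<phi>' \<in> faces X" "ff \<phi>' = \<phi>" "origin X (hd (bnd X \<phi>')) = v"
    using face_lift[OF walk_endD[OF rs(1)] \<phi>(1)] rs(3) by metis
  obtain as' bs' where ab: "bnd X \<phi>' = as' @ bs'" "map oe as' = as" "map oe bs' = bs"
    using map_bnd[OF \<phi>'(1)] \<phi>(2) \<phi>'(2) by (auto simp: append_eq_map_conv)
  obtain u' where u': "walk X v as' u'" "walk X u' bs' v"
    using face_walk(1)[OF complex(1) \<phi>'(1)] \<phi>'(3) ab(1) by (auto simp: walk_append)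
  have "map oe as' = map oe (rpath rs)" using rs(2) ab(2) by (simp add: map_omap_rpath)
  then have "u' = u"
    using walk_lift_unique[OF u'(1) walk_rpath[OF complex(1) rs(1)]] by blast
  with \<phi>' ab u' that show ?thesis by blast
qed

text \<open>Incidences lift upwards: this is the local surjectivity of a covering on open stars of cells.\<close>
lemma coface_lift:
  assumes \<sigma>: "\<sigma> \<in> cells X" and \<tau>: "\<tau> \<in> cells Y" and b: "mc \<sigma> \<in> boundary_cells Y \<tau>"
  shows "\<exists>\<sigma>' \<in> cells X. mc \<sigma>' = \<tau> \<and> \<sigma> \<in> boundary_cells X \<sigma>'"
proof (cases \<tau>)
  case (Vert v)
  then show ?thesis using b by simp
next
  case (Edge e)
  then obtain v where v: "\<sigma> = Vert v" "v \<in> verts X" and e: "e \<in> edges Y"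
    using b \<sigma> \<tau> by (cases \<sigma>) (auto simp: cells_def)
  then obtain d where d: "fst d = e" "origin Y d = fv v"
    using b Edge by (auto simp: origin_def intro: that[of "(e, True)"] that[of "(e, False)"])
  then obtain d' where d': "fst d' \<in> edges X" "origin X d' = v" "oe d' = d"
    using edge_lift[of v d] v(2) e by metis
  have "mc (Edge (fst d')) = \<tau>" using d'(3) d(1) Edge by (metis cell.map(2) fst_omap)
  moreover have "\<sigma> \<in> boundary_cells X (Edge (fst d'))"
    unfolding boundary_edge_ends using d'(2) v(1) by simp
  moreover have "Edge (fst d') \<in> cells X" using d'(1) by (simp add: cells_def)
  ultimately show ?thesis by blast
next
  case (Face \<phi>)
  then have \<phi>: "\<phi> \<in> faces Y" using \<tau> by (auto simp: cells_def)
  let ?o = "origin Y (hd (bnd Y \<phi>))"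
  note fw = face_walk[OF complex(2) \<phi>]
  obtain d where d: "d \<in> set (bnd Y \<phi>)"
    "mc \<sigma> \<in> {Edge (fst d), Vert (origin Y d), Vert (terminus Y d)}"
    using b Face by auto
  obtain as bs where ab: "bnd Y \<phi> = as @ d # bs" using d(1) by (meson split_list)
  have w: "walk Y ?o as (origin Y d)" "walk Y ?o (as @ [d]) (terminus Y d)"
    using fw(1) unfolding ab by (auto simp: walk_append dest: walk_startD)
  consider (edge) d' where "\<sigma> = Edge (fst d')" "fst d' \<in> edges X" "oe d' = d"
    | (start) v where "\<sigma> = Vert v" "v \<in> verts X" "fv v = origin Y d"
    | (finish) v where "\<sigma> = Vert v" "v \<in> verts X" "fv v = terminus Y d"
  proof (cases \<sigma>)
    case (Edge e)
    then show ?thesis using d(2) \<sigma> that(1)[of "(e, snd d)"] by (auto simp: cells_def omap_def)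
  qed (use d(2) \<sigma> that in \<open>auto simp: cells_def\<close>)
  then show ?thesis
  proof cases
    case edge
    have "fv (origin X d') = origin Y d" using edge(3) map_ends(1)[OF edge(2)] by simp
    then obtain \<phi>' as' bs' v where *: "\<phi>' \<in> faces X" "ff \<phi>' = \<phi>" "bnd X \<phi>' = as' @ bs'"
      "map oe bs' = d # bs" "walk X (origin X d') bs' v"
      using face_lift_at[OF edge_ends(1)[OF complex(1) edge(2)] \<phi> ab] w(1) by metis
    obtain d'' cs where c: "bs' = d'' # cs" "oe d'' = d" using *(4) by auto
    with *(5) edge edge_inj[of d'' d'] have "d'' = d'" by auto
    then show ?thesis using * c edge Face
      by (intro bexI[of _ "Face \<phi>'"]) (auto simp: cells_def)
  next
    case start
    then obtain \<phi>' as' bs' u where *: "\<phi>' \<in> faces X" "ff \<phi>' = \<phi>" "bnd X \<phi>' = as' @ bs'"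
      "map oe bs' = d # bs" "walk X v bs' u"
      using face_lift_at[OF start(2) \<phi> ab] w(1) by metis
    then obtain d' where "d' \<in> set bs'" "origin X d' = v"
      using walk_hd[OF *(5)] hd_in_set[of bs'] by force
    then show ?thesis using * start Face
      by (intro bexI[of _ "Face \<phi>'"]) (force simp: cells_def)+
  next
    case finish
    have ab': "bnd Y \<phi> = (as @ [d]) @ bs" using ab by simp
    then obtain \<phi>' as' bs' u where *: "\<phi>' \<in> faces X" "ff \<phi>' = \<phi>" "bnd X \<phi>' = as' @ bs'"
      "map oe as' = as @ [d]" "walk X u as' v"
      using face_lift_at[OF finish(2) \<phi> ab'] w(2) finish(3) by metis
    then obtain d' where "d' \<in> set as'" "terminus X d' = v"
      using walk_last[OF *(5)] by force
    then show ?thesis using * finish Face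
      by (intro bexI[of _ "Face \<phi>'"]) (force simp: cells_def)+
  qed
qed

text \<open>Let \<open>\<sigma>\<close> lie in a component \<open>C\<close> of the complement of the skeleton with finitely many faces.
  If its image is not in the skeleton of \<open>Y\<close>, then every chain of incident cells in the
  complement that starts at the image lifts to a chain that starts at \<open>\<sigma>\<close>, and this lift stays
  in the complement because skeleton cells map to skeleton cells.
  So the component of the image is covered by cells of \<open>C\<close>.\<close>

lemma core_cells_map:
  assumes "\<sigma> \<in> core_cells X" "\<sigma> \<in> cells X"
  shows "mc \<sigma> \<in> core_cells Y"
proof (cases "mc \<sigma> \<in> core_skeleton Y")
  case True
  then show ?thesis by (simp add: core_cells_def)
next
  case False
  let ?A = "compl_adj X (core_skeleton X)" and ?B = "compl_adj Y (core_skeleton Y)"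
  have "\<sigma> \<notin> core_skeleton X" using False core_skeleton_map by blast
  then obtain \<sigma>0 where \<sigma>0: "?A\<^sup>*\<^sup>* \<sigma>0 \<sigma>" "finite {\<phi>. Face \<phi> \<in> {\<tau>. ?A\<^sup>*\<^sup>* \<sigma>0 \<tau>}}"
    using assms(1) by (auto simp: core_cells_def compl_components_def)
  have lift: "\<exists>\<sigma>'. ?A\<^sup>*\<^sup>* \<sigma> \<sigma>' \<and> \<sigma>' \<in> cells X \<and> mc \<sigma>' = \<tau>" if "?B\<^sup>*\<^sup>* (mc \<sigma>) \<tau>" for \<tau>
    using that
  proof (induction rule: rtranclp_induct)
    case base
    then show ?case using assms(2) by blast
  next
    case (step \<tau> \<tau>')
    then obtain \<sigma>' where \<sigma>': "?A\<^sup>*\<^sup>* \<sigma> \<sigma>'" "\<sigma>' \<in> cells X" "mc \<sigma>' = \<tau>" by blast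
    have \<tau>': "\<tau>' \<in> cells Y" "\<tau>' \<notin> core_skeleton Y" "\<tau> \<notin> core_skeleton Y"
      "\<tau> \<in> boundary_cells Y \<tau>' \<or> \<tau>' \<in> boundary_cells Y \<tau>"
      using step.hyps(2) by (auto simp: compl_adj_def)
    have "\<exists>\<sigma>'' \<in> cells X. mc \<sigma>'' = \<tau>' \<and>
      (\<sigma>' \<in> boundary_cells X \<sigma>'' \<or> \<sigma>'' \<in> boundary_cells X \<sigma>')"
      using \<tau>'(4)
    proof
      assume "\<tau> \<in> boundary_cells Y \<tau>'"
      then show ?thesis using coface_lift[OF \<sigma>'(2) \<tau>'(1)] \<sigma>'(3) by auto
    next
      assume "\<tau>' \<in> boundary_cells Y \<tau>"
      then show ?thesis
        using mc_boundary[OF \<sigma>'(2)] \<sigma>'(3) boundary_cells_cells[OF complex(1) \<sigma>'(2)] by auto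
    qed
    then obtain \<sigma>'' where \<sigma>'': "\<sigma>'' \<in> cells X" "mc \<sigma>'' = \<tau>'"
      "\<sigma>' \<in> boundary_cells X \<sigma>'' \<or> \<sigma>'' \<in> boundary_cells X \<sigma>'" by blast
    then have "?A \<sigma>' \<sigma>''"
      using \<sigma>' \<tau>' core_skeleton_map unfolding compl_adj_def by blast
    then have "?A\<^sup>*\<^sup>* \<sigma> \<sigma>''" using \<sigma>'(1) by simp
    then show ?case using \<sigma>'' by blast
  qed
  have "{\<phi>. Face \<phi> \<in> {\<tau>. ?B\<^sup>*\<^sup>* (mc \<sigma>) \<tau>}} \<subseteq> ff ` {\<phi>. Face \<phi> \<in> {\<tau>. ?A\<^sup>*\<^sup>* \<sigma>0 \<tau>}}"
  proof
    fix \<phi> assume "\<phi> \<in> {\<phi>. Face \<phi> \<in> {\<tau>. ?B\<^sup>*\<^sup>* (mc \<sigma>) \<tau>}}"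
    then obtain \<sigma>' where "?A\<^sup>*\<^sup>* \<sigma> \<sigma>'" "mc \<sigma>' = Face \<phi>" using lift by blast
    then obtain \<phi>' where "?A\<^sup>*\<^sup>* \<sigma>0 (Face \<phi>')" "ff \<phi>' = \<phi>"
      using \<sigma>0(1) by (cases \<sigma>') (auto dest: rtranclp_trans)
    then show "\<phi> \<in> ff ` {\<phi>. Face \<phi> \<in> {\<tau>. ?A\<^sup>*\<^sup>* \<sigma>0 \<tau>}}" by blast
  qed
  then have "finite {\<phi>. Face \<phi> \<in> {\<tau>. ?B\<^sup>*\<^sup>* (mc \<sigma>) \<tau>}}"
    using \<sigma>0(2) finite_surj by blast
  then show ?thesis
    using False mc_cells[OF assms(2)] unfolding core_cells_def compl_components_def by blast
qed

lemma morphism_restrict: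
  assumes "is_complex (subcomplex X S)" "is_complex (subcomplex Y T)"
    and "\<And>\<sigma>. \<sigma> \<in> S \<Longrightarrow> \<sigma> \<in> cells X \<Longrightarrow> mc \<sigma> \<in> T"
  shows "morphism (subcomplex X S) (subcomplex Y T) (fv, fe, ff)"
proof -
  have "Vert (fv v) \<in> T" if "v \<in> verts X" "Vert v \<in> S" for v
    using assms(3)[of "Vert v"] that by (simp add: cells_def)
  moreover have "Edge (fe e) \<in> T" if "e \<in> edges X" "Edge e \<in> S" for e
    using assms(3)[of "Edge e"] that by (simp add: cells_def)
  moreover have "Face (ff \<phi>) \<in> T" if "\<phi> \<in> faces X" "Face \<phi> \<in> S" for \<phi>
    using assms(3)[of "Face \<phi>"] that by (simp add: cells_def)
  ultimately show ?thesis
    using morphism assms(1,2) by (auto simp: morphism_def subcomplex_def)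
qed

lemma core_morphism:
  "morphism (subcomplex X (core_cells X)) (subcomplex Y (core_cells Y)) (fv, fe, ff)"
  by (intro morphism_restrict subcomplex_complex complex core_cells_closed core_cells_map)

end

text \<open>Guarantees that the core of a nontrivial group is not empty.\<close>
lemma essential_homotopic_shortest:
  assumes "is_complex X" "essential X z"
  obtains z' where "freely_homotopic X z z'" "path_cells X z' \<subseteq> core_skeleton X"
proof -
  define z' where "z' = arg_min path_length (freely_homotopic X z)"
  have z': "freely_homotopic X z z'"
    and m: "\<And>y. freely_homotopic X z y \<Longrightarrow> path_length z' \<le> path_length y"
    unfolding z'_def by (rule arg_min_natI[of _ z], simp) (rule arg_min_nat_le, simp)
  have "essential X z'"
    using assms(2) freely_homotopic_cycle[OF assms(1) z'] freely_homotopic_trans[OF z']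
    unfolding essential_def by blast
  moreover have "\<forall>y. is_cycle X y \<and> freely_homotopic X z' y \<longrightarrow> path_length z' \<le> path_length y"
    using m freely_homotopic_trans[OF z'] by blast
  ultimately have "path_cells X z' \<subseteq> core_skeleton X"
    unfolding core_skeleton_def by blast
  with z' that show ?thesis by blast
qed


section \<open>The universal cover\<close>

locale pointed_complex =
  fixes X :: "('v, 'e, 'f, 'l) complex2" and x0 :: 'v
  assumes X: "is_complex X" and x0: "x0 \<in> verts X"
begin

abbreviation "U \<equiv> ucover X x0"
abbreviation "G \<equiv> pi1 X x0"
abbreviation "cl ds \<equiv> hclass X (x0, ds)"
abbreviation "v0 \<equiv> hclass X (x0, [])"

lemma hclass_eq: "hclass X p = hclass X q \<longleftrightarrow> homotopic X p q"
  unfolding hclass_def using homotopic_refl homotopic_sym homotopic_trans by blast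

lemma cl_append_cong:
  assumes "cl xs = cl ys" "walk X x0 xs a" "walk X a ds w"
  shows "cl (xs @ ds) = cl (ys @ ds)"
  using homotopic_append[OF X, of "(x0, xs)" "(x0, ys)" x0 "[]" a ds w] assms x0
  by (simp add: hclass_eq)

lemma cl_backtrack:
  assumes "walk X x0 xs a" "fst d \<in> edges X" "origin X d = a"
  shows "cl (xs @ [d, flip d]) = cl xs"
  using hstepI[OF X elementary_backtrack, of x0 xs a d "[]" a] assms edge_ends[OF X, of d]
  by (auto simp: hclass_eq intro!: homotopic_sym[OF hstep_homotopic])

lemma cl_face:
  assumes "walk X x0 xs (origin X (hd (bnd X \<phi>)))" "\<phi> \<in> faces X"
  shows "cl (xs @ bnd X \<phi>) = cl xs"
  using hstepI[OF X elementary_face[OF assms(2)] assms(1), of "[]"] face_walk[OF X assms(2)]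
    walk_endD[OF assms(1)]
  by (auto simp: hclass_eq intro!: homotopic_sym[OF hstep_homotopic])

lemma extend_cl:
  assumes "walk X x0 xs a" "fst d \<in> edges X" "origin X d = a"
  shows "extend X (cl xs) d = cl (xs @ [d])"
proof -
  have "hclass X (fst p, snd p @ [d]) = cl (xs @ [d])" if "p \<in> cl xs" for p
  proof -
    have h: "homotopic X (x0, xs) p" using that by (simp add: hclass_def)
    then obtain zs where p: "p = (x0, zs)" using homotopic_ends[OF X h] by (cases p) auto
    have "walk X a [d] (terminus X d)" using assms edge_ends[OF X, of d] by auto
    moreover have "cl xs = cl zs" using h p by (simp add: hclass_eq)
    ultimately have "cl (xs @ [d]) = cl (zs @ [d])" using cl_append_cong assms(1) by blast
    then show ?thesis using p by simp
  qed
  moreover have "cl xs \<noteq> {}" using homotopic_refl unfolding hclass_def by blast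
  ultimately show ?thesis unfolding extend_def by (intro SUP_eq_const) auto
qed

lemma cmult_cl:
  assumes "walk X x0 gs x0" "walk X x0 xs a"
  shows "cmult X (cl gs) (cl xs) = cl (gs @ xs)"
proof -
  have "hclass X (fst p, snd p @ snd q) = cl (gs @ xs)" if pq: "p \<in> cl gs" "q \<in> cl xs" for p q
  proof -
    have p: "homotopic X (x0, gs) p" and q: "homotopic X (x0, xs) q"
      using pq by (simp_all add: hclass_def)
    have e: "fst p = x0" "walk X x0 (snd p) x0" "fst q = x0"
      using homotopic_ends[OF X p] homotopic_ends[OF X q] assms(1) by auto
    have "homotopic X (x0, gs @ xs) (x0, snd p @ xs)"
      using homotopic_append[OF X p, of x0 "[]" x0 xs a] assms x0 by simp
    moreover have "homotopic X (x0, snd p @ xs) (x0, snd p @ snd q)"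
      using homotopic_append[OF X q, of x0 "snd p" a "[]" a] assms walk_endD[OF assms(2)] e
      by simp
    ultimately have "homotopic X (x0, gs @ xs) (x0, snd p @ snd q)" by (rule homotopic_trans)
    then show ?thesis using e(1) by (simp add: hclass_eq homotopic_sym)
  qed
  moreover have "cl gs \<noteq> {}" "cl xs \<noteq> {}" using homotopic_refl unfolding hclass_def by blast+
  ultimately show ?thesis unfolding cmult_def by (intro SUP_eq_const) auto
qed

lemma verts_U: "c \<in> verts U \<longleftrightarrow> (\<exists>xs a. c = cl xs \<and> walk X x0 xs a)"
  by (fastforce simp: ucover_def is_path_def)

lemma edges_U:
  "(c, e) \<in> edges U \<longleftrightarrow> (\<exists>xs. c = cl xs \<and> walk X x0 xs (src X e) \<and> e \<in> edges X)"
proof -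
  have "is_path X (x0, xs) \<and> e \<in> edges X \<and> is_path X (x0, xs @ [(e, True)]) \<longleftrightarrow>
      walk X x0 xs (src X e) \<and> e \<in> edges X" for xs
    using edge_ends[OF X, of "(e, True)"]
    by (auto simp: is_path_def walk_append origin_def terminus_def)
  then show ?thesis unfolding ucover_def by (auto 0 3)
qed

lemma faces_U:
  "(c, \<phi>) \<in> faces U \<longleftrightarrow>
    (\<exists>xs. c = cl xs \<and> walk X x0 xs (origin X (hd (bnd X \<phi>))) \<and> \<phi> \<in> faces X)"
proof -
  have "is_path X (x0, xs) \<and> \<phi> \<in> faces X \<and> is_path X (x0, xs @ bnd X \<phi>) \<longleftrightarrow>
      walk X x0 xs (origin X (hd (bnd X \<phi>))) \<and> \<phi> \<in> faces X" for xs
    using face_walk[OF X, of \<phi>] walk_hd[of X _ "bnd X \<phi>"]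
    by (fastforce simp: is_path_def walk_append)
  then show ?thesis unfolding ucover_def by (auto 0 3)
qed

lemma U_simps [simp]:
  "src U (c, e) = c" "tgt U (c, e) = extend X c (e, True)" "lab U (c, e) = lab X e"
  "bnd U (c, \<phi>) = lift X c (bnd X \<phi>)"
  by (simp_all add: ucover_def)

text \<open>One step of \<^const>\<open>lift\<close>, split off so that the two orientations of an edge are treated
  only once.\<close>

definition lift1 :: "('v, 'e) epath set \<Rightarrow> 'e oedge \<Rightarrow> (('v, 'e) epath set \<times> 'e) oedge" where
  "lift1 c d = ((if snd d then c else extend X c d, fst d), snd d)"

lemma lift_Cons: "lift X c (d # ds) = lift1 c d # lift X (extend X c d) ds"
  by (simp add: lift1_def)

lemma lift1:
  assumes "walk X x0 xs (origin X d)" "fst d \<in> edges X"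
  shows "fst (lift1 (cl xs) d) \<in> edges U" "origin U (lift1 (cl xs) d) = cl xs"
    "terminus U (lift1 (cl xs) d) = cl (xs @ [d])"
proof -
  have ext: "extend X (cl xs) d = cl (xs @ [d])" using extend_cl assms by blast
  have w: "walk X x0 (xs @ [d]) (terminus X d)"
    using assms edge_ends[OF X, of d] by (auto simp: walk_append)
  have "extend X (cl (xs @ [d])) (flip d) = cl ((xs @ [d]) @ [flip d])"
    using extend_cl[OF w, of "flip d"] assms by simp
  then have ret: "extend X (cl (xs @ [d])) (flip d) = cl xs"
    using cl_backtrack[OF assms(1), of d] assms by simp
  show "fst (lift1 (cl xs) d) \<in> edges U"
    using assms w ext by (cases d; cases "snd d")
      (auto simp: lift1_def edges_U origin_def terminus_def)
  show "origin U (lift1 (cl xs) d) = cl xs" "terminus U (lift1 (cl xs) d) = cl (xs @ [d])"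
    using ext ret by (cases d; cases "snd d"; simp add: lift1_def origin_def terminus_def flip_def)+
qed

text \<open>The lift of a path to the universal cover records the classes of its initial segments.\<close>
lemma lift_walk:
  assumes "walk X x0 xs a" "walk X a ds b"
  shows "walk U (cl xs) (lift X (cl xs) ds) (cl (xs @ ds))"
  using assms
proof (induction ds arbitrary: xs a)
  case Nil
  then show ?case by (auto simp: verts_U)
next
  case (Cons d ds)
  then have d: "walk X x0 xs (origin X d)" "fst d \<in> edges X" and w: "walk X (terminus X d) ds b"
    by auto
  then have "walk X x0 (xs @ [d]) (terminus X d)"
    using edge_ends[OF X, of d] by (auto simp: walk_append)
  then have "walk U (cl (xs @ [d])) (lift X (cl (xs @ [d])) ds) (cl ((xs @ [d]) @ ds))"
    using Cons.IH w by blast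
  then show ?case
    using lift1[OF d] extend_cl[OF d(1,2)] d(1) unfolding lift_Cons by (auto simp: verts_U)
qed

lemma U_complex: "is_complex U"
proof -
  have "src U x \<in> verts U \<and> tgt U x \<in> verts U" if "x \<in> edges U" for x
  proof -
    obtain c e where x: "x = (c, e)" by (cases x)
    then obtain xs where xs: "c = cl xs" "walk X x0 xs (src X e)" "e \<in> edges X"
      using \<open>x \<in> edges U\<close> by (auto simp: edges_U)
    then have "walk X x0 (xs @ [(e, True)]) (tgt X e)"
      using edge_ends[OF X, of "(e, True)"] by (auto simp: walk_append origin_def terminus_def)
    then show ?thesis
      using x xs extend_cl[OF xs(2), of "(e, True)"] by (auto simp: verts_U origin_def)
  qed
  moreover have "bnd U y \<noteq> [] \<and> is_cycle U (origin U (hd (bnd U y)), bnd U y)"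
    if "y \<in> faces U" for y
  proof -
    obtain c \<phi> where y: "y = (c, \<phi>)" by (cases y)
    then obtain xs where xs: "c = cl xs" "walk X x0 xs (origin X (hd (bnd X \<phi>)))" "\<phi> \<in> faces X"
      using \<open>y \<in> faces U\<close> by (auto simp: faces_U)
    have ne: "lift X c (bnd X \<phi>) \<noteq> []"
      using face_walk(2)[OF X xs(3)] by (cases "bnd X \<phi>") auto
    have "walk U c (lift X c (bnd X \<phi>)) c"
      using lift_walk[OF xs(2) face_walk(1)[OF X xs(3)]] cl_face[OF xs(2,3)] xs(1) by simp
    then show ?thesis using ne walk_hd[of U c "lift X c (bnd X \<phi>)" c] y by (simp add: is_cycle_def)
  qed
  ultimately show ?thesis unfolding is_complex_def by blast
qed

text \<open>Homotopic paths have the same end, so a vertex of the universal cover lies over a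
  well-defined vertex.\<close>

definition endpoint :: "('v, 'e) epath set \<Rightarrow> 'v" where
  "endpoint c = (SOME a. \<exists>p \<in> c. walk X (fst p) (snd p) a)"

lemma endpoint_cl:
  assumes "walk X x0 xs a"
  shows "endpoint (cl xs) = a"
proof -
  have unique: "b = a" if "p \<in> cl xs" "walk X (fst p) (snd p) b" for p b
    using homotopic_ends[OF X, of "(x0, xs)" p b] that walk_det[OF assms, of b]
    by (simp add: hclass_def)
  have "\<exists>p \<in> cl xs. walk X (fst p) (snd p) a"
    using assms by (intro bexI[of _ "(x0, xs)"]) (simp_all add: hclass_def)
  then show ?thesis
    unfolding endpoint_def by (rule some_equality) (use unique in blast)
qed

lemma omap_lift1 [simp]: "omap snd (lift1 c d) = d"
  by (simp add: omap_def lift1_def)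

lemma map_omap_lift [simp]: "map (omap snd) (lift X c ds) = ds"
  by (induction ds arbitrary: c) (simp_all add: omap_def)

text \<open>For an edge traversed backwards this says that its source is recovered from its target: extending
  a class by the edge and then by the reversed edge is a backtrack.\<close>
lemma lift1_origin:
  assumes "fst d \<in> edges U"
  shows "d = lift1 (origin U d) (omap snd d)"
proof -
  obtain c e s where d: "d = ((c, e), s)" by (metis surj_pair)
  then obtain xs where xs: "c = cl xs" "walk X x0 xs (src X e)" "e \<in> edges X"
    using assms by (auto simp: edges_U)
  show ?thesis
  proof (cases s)
    case True
    then show ?thesis using d by (simp add: lift1_def omap_def origin_def)
  next
    case False
    have w: "walk X x0 (xs @ [(e, True)]) (tgt X e)"
      using xs edge_ends[OF X, of "(e, True)"] by (auto simp: walk_append origin_def terminus_def)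
    have 1: "extend X c (e, True) = cl (xs @ [(e, True)])"
      using extend_cl[OF xs(2), of "(e, True)"] xs by (simp add: origin_def)
    have 2: "extend X (cl (xs @ [(e, True)])) (e, False) = c"
      using extend_cl[OF w, of "(e, False)"] xs cl_backtrack[OF xs(2), of "(e, True)"]
      by (simp add: origin_def flip_def)
    show ?thesis using False d 1 2 by (simp add: lift1_def omap_def origin_def)
  qed
qed

lemma covering_U: "covering U X endpoint snd snd"
proof
  show "morphism U X (endpoint, snd, snd)"
  proof -
    have "endpoint (src U x) = src X (snd x) \<and> endpoint (tgt U x) = tgt X (snd x) \<and>
        lab U x = lab X (snd x) \<and> snd x \<in> edges X" if "x \<in> edges U" for x
    proof -
      obtain c e where x: "x = (c, e)" by (cases x)
      then obtain xs where xs: "c = cl xs" "walk X x0 xs (src X e)" "e \<in> edges X"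
        using \<open>x \<in> edges U\<close> by (auto simp: edges_U)
      then have "walk X x0 (xs @ [(e, True)]) (tgt X e)"
        using edge_ends[OF X, of "(e, True)"] by (auto simp: walk_append origin_def terminus_def)
      then show ?thesis
        using x xs extend_cl[OF xs(2), of "(e, True)"] by (simp add: endpoint_cl origin_def)
    qed
    moreover have "endpoint c \<in> verts X" if "c \<in> verts U" for c
      using that walk_endD by (fastforce simp: verts_U endpoint_cl)
    moreover have "snd y \<in> faces X \<and> map (omap snd) (bnd U y) = bnd X (snd y)" if "y \<in> faces U" for y
      using that by (cases y) (auto simp: faces_U)
    ultimately show ?thesis
      unfolding morphism_def prod.case map_prod_omap using X U_complex by auto
  qed
next
  fix c d assume "c \<in> verts U" "fst d \<in> edges X" "origin X d = endpoint c"
  then obtain xs where "c = cl xs" "walk X x0 xs (origin X d)"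
    by (auto simp: verts_U endpoint_cl)
  then show "\<exists>d'. fst d' \<in> edges U \<and> origin U d' = c \<and> omap snd d' = d"
    using lift1[of xs d] \<open>fst d \<in> edges X\<close> by (intro exI[of _ "lift1 c d"]) simp
next
  fix d d' assume "fst d \<in> edges U" "fst d' \<in> edges U" "origin U d = origin U d'"
    "omap snd d = omap snd d'"
  then show "d = d'" using lift1_origin by metis
next
  fix c \<phi> assume "c \<in> verts U" and \<phi>: "\<phi> \<in> faces X" and o: "origin X (hd (bnd X \<phi>)) = endpoint c"
  then obtain xs where xs: "c = cl xs" "walk X x0 xs (origin X (hd (bnd X \<phi>)))"
    by (auto simp: verts_U endpoint_cl)
  then have "(c, \<phi>) \<in> faces U" using \<phi> by (auto simp: faces_U)
  moreover have "origin U (hd (lift X c (bnd X \<phi>))) = c"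
  proof -
    have "lift X c (bnd X \<phi>) \<noteq> []" using face_walk(2)[OF X \<phi>] by (cases "bnd X \<phi>") auto
    then show ?thesis
      using walk_hd[OF lift_walk[OF xs(2) face_walk(1)[OF X \<phi>]]] xs(1) by simp
  qed
  ultimately show "\<exists>\<phi>' \<in> faces U. snd \<phi>' = \<phi> \<and> origin U (hd (bnd U \<phi>')) = c"
    by force
qed

text \<open>Simple connectedness in disguise: the end of a walk in the universal cover is
  determined by its start and by the homotopy class of its projection.\<close>
lemma walk_U_end:
  assumes "walk U (cl xs) ds c" "walk X x0 xs a"
  shows "c = cl (xs @ map (omap snd) ds)"
proof -
  interpret covering U X endpoint snd snd by (rule covering_U)
  have "walk X a (map (omap snd) ds) (endpoint c)"
    using walk_map[OF assms(1)] endpoint_cl[OF assms(2)] by simp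
  from lift_walk[OF assms(2) this] walk_lift_unique[OF assms(1)] show ?thesis by simp
qed

lemma carrier_pi1: "\<gamma> \<in> carrier G \<longleftrightarrow> (\<exists>gs. \<gamma> = cl gs \<and> walk X x0 gs x0)"
  by (fastforce simp: pi1_def is_cycle_def)

lemma one_pi1: "\<one>\<^bsub>G\<^esub> = v0"
  and mult_pi1: "\<gamma> \<otimes>\<^bsub>G\<^esub> \<delta> = cmult X \<gamma> \<delta>"
  by (simp_all add: pi1_def)

lemma cmult_assoc:
  assumes "\<gamma> \<in> carrier G" "\<delta> \<in> carrier G" "c \<in> verts U"
  shows "cmult X (cmult X \<gamma> \<delta>) c = cmult X \<gamma> (cmult X \<delta> c)"
proof -
  obtain gs ds xs a where *: "\<gamma> = cl gs" "walk X x0 gs x0" "\<delta> = cl ds" "walk X x0 ds x0"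
    "c = cl xs" "walk X x0 xs a"
    using assms unfolding carrier_pi1 verts_U by blast
  have "walk X x0 (gs @ ds) x0" "walk X x0 (ds @ xs) a" using * by (auto simp: walk_append)
  then show ?thesis using * by (simp add: cmult_cl)
qed

lemma carrier_verts: "carrier G \<subseteq> verts U"
proof
  fix \<gamma> assume "\<gamma> \<in> carrier G"
  then obtain gs where "\<gamma> = cl gs" "walk X x0 gs x0" unfolding carrier_pi1 by blast
  then show "\<gamma> \<in> verts U" unfolding verts_U by blast
qed

lemma group_pi1: "group G"
proof (rule groupI)
  show "\<one>\<^bsub>G\<^esub> \<in> carrier G" using x0 by (auto simp: carrier_pi1 one_pi1 intro!: exI[of _ "[]"])
next
  fix \<gamma> \<delta> assume "\<gamma> \<in> carrier G" "\<delta> \<in> carrier G"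
  then obtain gs ds where "\<gamma> = cl gs" "walk X x0 gs x0" "\<delta> = cl ds" "walk X x0 ds x0"
    unfolding carrier_pi1 by blast
  then show "\<gamma> \<otimes>\<^bsub>G\<^esub> \<delta> \<in> carrier G"
    unfolding carrier_pi1 mult_pi1
    by (intro exI[of _ "gs @ ds"]) (auto simp: cmult_cl walk_append)
next
  fix \<gamma> \<delta> \<rho> assume "\<gamma> \<in> carrier G" "\<delta> \<in> carrier G" "\<rho> \<in> carrier G"
  then show "\<gamma> \<otimes>\<^bsub>G\<^esub> \<delta> \<otimes>\<^bsub>G\<^esub> \<rho> = \<gamma> \<otimes>\<^bsub>G\<^esub> (\<delta> \<otimes>\<^bsub>G\<^esub> \<rho>)"
    using cmult_assoc carrier_verts by (auto simp: mult_pi1)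
next
  fix \<gamma> assume "\<gamma> \<in> carrier G"
  then obtain gs where g: "\<gamma> = cl gs" "walk X x0 gs x0" by (auto simp: carrier_pi1)
  then show "\<one>\<^bsub>G\<^esub> \<otimes>\<^bsub>G\<^esub> \<gamma> = \<gamma>" using cmult_cl[of "[]" gs] x0 by (simp add: one_pi1 mult_pi1)
  have r: "walk X x0 (rpath gs) x0" using walk_rpath[OF X g(2)] .
  have "cmult X (cl (rpath gs)) \<gamma> = v0"
    using cmult_cl[OF r g(2)] g(1) homotopic_rpath[OF X r] by (simp add: hclass_eq)
  then show "\<exists>\<delta> \<in> carrier G. \<delta> \<otimes>\<^bsub>G\<^esub> \<gamma> = \<one>\<^bsub>G\<^esub>"
    using r by (intro bexI[of _ "cl (rpath gs)"]) (auto simp: carrier_pi1 mult_pi1 one_pi1)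
qed

end


section \<open>Coverings between quotients of the universal cover\<close>

text \<open>The cell structure of a quotient is defined by images of cells, so that its being a complex
  is inherited from the complex above.\<close>
lemma morphism_onto:
  assumes X: "is_complex X"
    and onto: "verts Y = fv ` verts X" "edges Y = fe ` edges X" "faces Y = ff ` faces X"
    and ends: "\<And>e. e \<in> edges X \<Longrightarrow>
      src Y (fe e) = fv (src X e) \<and> tgt Y (fe e) = fv (tgt X e) \<and> lab Y (fe e) = lab X e"
    and bnd: "\<And>\<phi>. \<phi> \<in> faces X \<Longrightarrow> bnd Y (ff \<phi>) = map (omap fe) (bnd X \<phi>)"
  shows "morphism X Y (fv, fe, ff)"
proof -
  have o: "origin Y (omap fe d) = fv (origin X d)" "terminus Y (omap fe d) = fv (terminus X d)"
    if "fst d \<in> edges X" for d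
    using ends[OF that] by (simp_all add: origin_def terminus_def)
  have w: "walk Y (fv v) (map (omap fe) ds) (fv w)" if "walk X v ds w" for v ds w
    using that by (induction ds arbitrary: v) (auto simp: onto o)
  have "bnd Y (ff \<phi>) \<noteq> [] \<and> is_cycle Y (origin Y (hd (bnd Y (ff \<phi>))), bnd Y (ff \<phi>))"
    if \<phi>: "\<phi> \<in> faces X" for \<phi>
  proof -
    note f = face_walk[OF X \<phi>]
    have "fst (hd (bnd X \<phi>)) \<in> edges X" using walk_edges[OF f(1)] f(2) by simp
    then show ?thesis using w[OF f(1)] f(2) by (simp add: bnd[OF \<phi>] is_cycle_def hd_map o)
  qed
  moreover have "src X e \<in> verts X \<and> tgt X e \<in> verts X" if "e \<in> edges X" for e
    using X that by (simp add: is_complex_def)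
  ultimately have "is_complex Y"
    unfolding is_complex_def by (auto simp: onto ends)
  then show ?thesis
    unfolding morphism_def prod.case map_prod_omap using X ends bnd onto by auto
qed

text \<open>If the coverings of \<open>A\<close> and \<open>B\<close> by \<open>U\<close> are compatible with a cell map from \<open>A\<close> to \<open>B\<close>,
  then this map is a covering: lifts to \<open>A\<close> are the projections of lifts to \<open>U\<close>, and two
  edges of \<open>A\<close> at a common vertex can be compared after lifting them to a common vertex of \<open>U\<close>.
  It yields the coverings from the quotients to the base and the natural morphisms.\<close>
lemma covering_factor:
  assumes p: "covering U A pv pe pf" and q: "covering U B qv qe qf"
    and onto: "verts A = pv ` verts U" "edges A = pe ` edges U" "faces A = pf ` faces U"
    and fv: "\<And>v. v \<in> verts U \<Longrightarrow> fv (pv v) = qv v"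
    and fe: "\<And>e. e \<in> edges U \<Longrightarrow> fe (pe e) = qe e"
    and ff: "\<And>\<phi>. \<phi> \<in> faces U \<Longrightarrow> ff (pf \<phi>) = qf \<phi>"
  shows "covering A B fv fe ff"
proof -
  interpret p: covering U A pv pe pf by (rule p)
  interpret q: covering U B qv qe qf by (rule q)
  have oe: "omap fe (omap pe d) = omap qe d" if "fst d \<in> edges U" for d
    using fe[OF that] by (simp add: omap_def)
  have ends: "src A (pe e) = pv (src U e)" "tgt A (pe e) = pv (tgt U e)" "lab A (pe e) = lab U e"
    "src B (qe e) = qv (src U e)" "tgt B (qe e) = qv (tgt U e)" "lab B (qe e) = lab U e"
    "src U e \<in> verts U" "tgt U e \<in> verts U" if "e \<in> edges U" for e
    using p.morphism q.morphism that by (auto simp: morphism_def is_complex_def)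
  have over: "\<exists>d'. fst d' \<in> edges U \<and> origin U d' = u \<and> omap pe d' = d"
    if "fst d \<in> edges A" "u \<in> verts U" "origin A d = pv u" for d u
    using p.edge_lift that by blast
  show ?thesis
  proof
    have "map (omap fe) (bnd A (pf \<phi>)) = bnd B (qf \<phi>)" if \<phi>: "\<phi> \<in> faces U" for \<phi>
    proof -
      have "fst d \<in> edges U" if "d \<in> set (bnd U \<phi>)" for d
        using walk_edges[OF face_walk(1)[OF p.complex(1) \<phi>] that] .
      then show ?thesis using oe by (simp add: p.map_bnd[OF \<phi>] q.map_bnd[OF \<phi>])
    qed
    then show "morphism A B (fv, fe, ff)"
      unfolding morphism_def prod.case map_prod_omap
      using p.complex q.complex q.map_cells by (auto simp: onto fv fe ff ends)
  next
    fix v d assume v: "v \<in> verts A" and d: "fst d \<in> edges B" "origin B d = fv v"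
    then obtain u where u: "u \<in> verts U" "v = pv u" by (auto simp: onto)
    then obtain d' where "fst d' \<in> edges U" "origin U d' = u" "omap qe d' = d"
      using q.edge_lift[of u d] d fv by auto
    then show "\<exists>d'. fst d' \<in> edges A \<and> origin A d' = v \<and> omap fe d' = d"
      using u p.map_cells p.map_ends oe by (intro exI[of _ "omap pe d'"]) auto
  next
    fix d d' assume d: "fst d \<in> edges A" "fst d' \<in> edges A" "origin A d = origin A d'"
      and eq: "omap fe d = omap fe d'"
    obtain u where u: "u \<in> verts U" "origin A d = pv u"
      using edge_ends(1)[OF p.complex(2) d(1)] by (auto simp: onto)
    obtain a where a: "fst a \<in> edges U" "origin U a = u" "omap pe a = d"
      using over[OF d(1) u] by blast
    obtain b where b: "fst b \<in> edges U" "origin U b = u" "omap pe b = d'"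
      using over[OF d(2) u(1)] d(3) u(2) by auto
    have "omap qe a = omap qe b" using a b eq oe by metis
    then have "a = b" using q.edge_inj[of a b] a b by simp
    then show "d = d'" using a b by simp
  next
    fix v \<phi> assume v: "v \<in> verts A" and \<phi>: "\<phi> \<in> faces B" "origin B (hd (bnd B \<phi>)) = fv v"
    then obtain u where u: "u \<in> verts U" "v = pv u" by (auto simp: onto)
    then obtain \<psi> where \<psi>: "\<psi> \<in> faces U" "qf \<psi> = \<phi>" "origin U (hd (bnd U \<psi>)) = u"
      using q.face_lift[of u \<phi>] \<phi> fv by auto
    note f = face_walk[OF p.complex(1) \<psi>(1)]
    have "fst (hd (bnd U \<psi>)) \<in> edges U" using walk_edges[OF f(1)] f(2) by simp
    then have "origin A (hd (bnd A (pf \<psi>))) = v"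
      using u \<psi> f(2) by (simp add: p.map_bnd hd_map p.map_ends)
    then show "\<exists>\<phi>' \<in> faces A. ff \<phi>' = \<phi> \<and> origin A (hd (bnd A \<phi>')) = v"
      using \<psi> ff p.map_cells(3) by (intro bexI[of _ "pf \<psi>"]) auto
  qed
qed

locale quotient_complex = pointed_complex X x0
  for X :: "('v, 'e, 'f, 'l) complex2" and x0 :: 'v +
  fixes J :: "('v, 'e) epath set set"
  assumes J: "subgroup J (pi1 X x0)"
begin

abbreviation "Q \<equiv> quotient_cover X x0 J"
abbreviation "vo \<equiv> vorbit X J"
abbreviation "eo \<equiv> corbit X J :: ('v, 'e) epath set \<times> 'e \<Rightarrow> (('v, 'e) epath set \<times> 'e) set"
abbreviation "fo \<equiv> corbit X J :: ('v, 'e) epath set \<times> 'f \<Rightarrow> (('v, 'e) epath set \<times> 'f) set"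

lemma J_carrier: "\<gamma> \<in> J \<Longrightarrow> \<gamma> \<in> carrier G"
  by (rule subgroup.mem_carrier[OF J])

lemma J_loop:
  assumes "\<gamma> \<in> J"
  obtains gs where "\<gamma> = cl gs" "walk X x0 gs x0"
  using J_carrier[OF assms] unfolding carrier_pi1 by blast

lemma one_J: "v0 \<in> J"
  using subgroup.one_closed[OF J] by (simp add: one_pi1)

lemma v0_U: "v0 \<in> verts U"
  using subsetD[OF carrier_verts J_carrier[OF one_J]] .

lemma cmult_v0: "c \<in> verts U \<Longrightarrow> cmult X v0 c = c"
  using cmult_cl[of "[]"] x0 by (auto simp: verts_U)

lemma cmult_v0_right: "\<gamma> \<in> carrier G \<Longrightarrow> cmult X \<gamma> v0 = \<gamma>"
  using cmult_cl[of _ "[]" x0] x0 by (auto simp: carrier_pi1)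

lemma right_mult_J:
  assumes "\<gamma> \<in> J"
  shows "(\<lambda>\<delta>. cmult X \<delta> \<gamma>) ` J = J"
proof -
  interpret G: group G by (rule group_pi1)
  have "\<delta> \<in> (\<lambda>\<delta>. \<delta> \<otimes>\<^bsub>G\<^esub> \<gamma>) ` J" if "\<delta> \<in> J" for \<delta>
    using that assms subgroup.m_closed[OF J] subgroup.m_inv_closed[OF J] J_carrier
    by (intro image_eqI[of _ _ "\<delta> \<otimes>\<^bsub>G\<^esub> inv\<^bsub>G\<^esub> \<gamma>"]) (auto simp: G.m_assoc)
  then show ?thesis
    using assms subgroup.m_closed[OF J] by (auto simp: mult_pi1)
qed

lemma vo_shift:
  assumes "\<gamma> \<in> J" "c \<in> verts U"
  shows "vo (cmult X \<gamma> c) = vo c"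
proof -
  have "vo (cmult X \<gamma> c) = (\<lambda>\<delta>. cmult X (cmult X \<delta> \<gamma>) c) ` J"
    unfolding vorbit_def using cmult_assoc assms J_carrier by (intro image_cong) auto
  also have "\<dots> = (\<lambda>\<delta>. cmult X \<delta> c) ` (\<lambda>\<delta>. cmult X \<delta> \<gamma>) ` J" by (simp add: image_image)
  finally show ?thesis using right_mult_J[OF assms(1)] by (simp add: vorbit_def)
qed

lemma corbit_vo: "corbit X J (c, y) = (\<lambda>c'. (c', y)) ` vo c"
  by (simp add: corbit_def vorbit_def image_image)

lemma corbit_shift:
  assumes "\<gamma> \<in> J" "c \<in> verts U"
  shows "corbit X J (cmult X \<gamma> c, y) = corbit X J (c, y)"
  by (simp add: corbit_vo vo_shift[OF assms])

lemma vo_self: "c \<in> verts U \<Longrightarrow> c \<in> vo c"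
  unfolding vorbit_def using one_J cmult_v0 by (intro image_eqI[of _ _ v0]) auto

lemma vo_eqD:
  assumes "vo c = vo c'" "c \<in> verts U"
  shows "\<exists>\<gamma> \<in> J. c = cmult X \<gamma> c'"
  using vo_self[OF assms(2)] assms(1) by (auto simp: vorbit_def)

lemma corbit_snd: "corbit X J (c, y) = corbit X J (c', y') \<Longrightarrow> c \<in> verts U \<Longrightarrow> y = y'"
  using vo_self[of c] unfolding corbit_vo by blast

lemma extend_cmult:
  assumes \<gamma>: "\<gamma> \<in> J" and xs: "walk X x0 xs (origin X d)" and d: "fst d \<in> edges X"
  shows "extend X (cmult X \<gamma> (cl xs)) d = cmult X \<gamma> (extend X (cl xs) d)"
proof -
  obtain gs where gs: "\<gamma> = cl gs" "walk X x0 gs x0" using J_loop[OF \<gamma>] .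
  have "walk X x0 (gs @ xs) (origin X d)" "walk X x0 (xs @ [d]) (terminus X d)"
    using gs xs d edge_ends[OF X d] by (auto simp: walk_append)
  then show ?thesis using gs xs d by (simp add: cmult_cl extend_cl)
qed

text \<open>The deck group acts on lifts, so the attaching word of an orbit of faces is well defined.\<close>
lemma lift_orbit:
  assumes \<gamma>: "\<gamma> \<in> J" and "walk X x0 xs a" "walk X a ds b"
  shows "map (omap eo) (lift X (cmult X \<gamma> (cl xs)) ds) = map (omap eo) (lift X (cl xs) ds)"
  using assms(2,3)
proof (induction ds arbitrary: xs a)
  case (Cons d ds)
  then have d: "walk X x0 xs (origin X d)" "fst d \<in> edges X" by auto
  have ext: "extend X (cl xs) d = cl (xs @ [d])" using d extend_cl by blast
  have w: "walk X x0 (xs @ [d]) (terminus X d)"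
    using d edge_ends[OF X d(2)] by (auto simp: walk_append)
  have "cl xs \<in> verts U" "cl (xs @ [d]) \<in> verts U" using d(1) w verts_U by blast+
  then have "omap eo (lift1 (cmult X \<gamma> (cl xs)) d) = omap eo (lift1 (cl xs) d)"
    using extend_cmult[OF \<gamma> d] ext by (simp add: lift1_def omap_def corbit_shift[OF \<gamma>])
  then show ?case
    using Cons.IH[OF w] Cons.prems extend_cmult[OF \<gamma> d] ext unfolding lift_Cons by simp
qed simp

lemma Q_cells: "verts Q = vo ` verts U" "edges Q = eo ` edges U" "faces Q = fo ` faces U"
  by (simp_all add: quotient_cover_def Let_def)

lemma the_elem_const: "S \<noteq> {} \<Longrightarrow> (\<And>x. x \<in> S \<Longrightarrow> h x = y) \<Longrightarrow> the_elem (h ` S) = y"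
  by (metis (no_types, lifting) image_cong image_constant_conv the_elem_eq)

lemma Q_edge:
  assumes "(c, e) \<in> edges U"
  shows "src Q (eo (c, e)) = vo c" "tgt Q (eo (c, e)) = vo (extend X c (e, True))"
    "lab Q (eo (c, e)) = lab X e"
proof -
  obtain xs where xs: "c = cl xs" "walk X x0 xs (src X e)" "e \<in> edges X"
    using assms by (auto simp: edges_U)
  have ne: "eo (c, e) \<noteq> {}" using one_J by (auto simp: corbit_def)
  show "src Q (eo (c, e)) = vo c"
    by (simp add: quotient_cover_def Let_def corbit_vo image_image)
  have "extend X (cmult X \<gamma> c) (e, True) = cmult X \<gamma> (extend X c (e, True))" if "\<gamma> \<in> J" for \<gamma>
    using extend_cmult[OF that, of xs "(e, True)"] xs by (simp add: origin_def)
  then show "tgt Q (eo (c, e)) = vo (extend X c (e, True))"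
    by (simp add: quotient_cover_def Let_def corbit_def vorbit_def image_image)
  have "the_elem (lab U ` eo (c, e)) = lab X e"
    using ne by (rule the_elem_const) (auto simp: corbit_def)
  then show "lab Q (eo (c, e)) = lab X e"
    by (simp add: quotient_cover_def Let_def)
qed

lemma Q_origin: "fst d \<in> edges U \<Longrightarrow> origin Q (omap eo d) = vo (origin U d)"
  by (cases d; cases "fst d") (simp add: origin_def Q_edge)

lemma Q_face:
  assumes "(c, \<phi>) \<in> faces U"
  shows "bnd Q (fo (c, \<phi>)) = map (omap eo) (lift X c (bnd X \<phi>))"
proof -
  obtain xs where xs: "c = cl xs" "walk X x0 xs (origin X (hd (bnd X \<phi>)))" "\<phi> \<in> faces X"
    using assms by (auto simp: faces_U)
  have "map (omap eo) (bnd U y) = map (omap eo) (lift X c (bnd X \<phi>))" if y: "y \<in> fo (c, \<phi>)" for y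
  proof -
    obtain \<gamma> where "\<gamma> \<in> J" "y = (cmult X \<gamma> c, \<phi>)" using y by (auto simp: corbit_def)
    then show ?thesis using lift_orbit[OF _ xs(2) face_walk(1)[OF X xs(3)]] xs(1) by simp
  qed
  moreover have "fo (c, \<phi>) \<noteq> {}" using one_J by (auto simp: corbit_def)
  ultimately have "the_elem ((\<lambda>y. map (omap eo) (bnd U y)) ` fo (c, \<phi>)) =
      map (omap eo) (lift X c (bnd X \<phi>))" by (intro the_elem_const)
  then show ?thesis by (simp add: quotient_cover_def Let_def map_prod_omap)
qed

text \<open>A cell of the quotient that starts at the orbit of \<open>c\<close> has a representative that
  starts at a translate of \<open>c\<close>, and translating this representative back gives the lift at \<open>c\<close>.
  Lifts are unique because the projection to the quotient can be followed by the one to the base,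
  where uniqueness is known.\<close>
lemma covering_Q: "covering U Q vo eo fo"
proof
  show "morphism U Q (vo, eo, fo)"
    by (rule morphism_onto[OF U_complex Q_cells]) (auto simp: Q_edge Q_face)
next
  fix c d assume c: "c \<in> verts U" and d: "fst d \<in> edges Q" "origin Q d = vo c"
  obtain b e s where b: "d = (eo (b, e), s)" "(b, e) \<in> edges U"
    using d(1) by (cases d) (auto simp: Q_cells)
  obtain xs where xs: "b = cl xs" "walk X x0 xs (src X e)" "e \<in> edges X"
    using b(2) by (auto simp: edges_U)
  have w: "walk X x0 (xs @ [(e, True)]) (tgt X e)"
    using xs edge_ends[OF X, of "(e, True)"] by (auto simp: walk_append origin_def terminus_def)
  have ext: "extend X b (e, True) = cl (xs @ [(e, True)])"
    using extend_cl[OF xs(2), of "(e, True)"] xs by (simp add: origin_def)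
  have bU: "b \<in> verts U" using xs verts_U by blast
  \<comment> \<open>Some representative of the edge starts in the orbit of \<open>c\<close>, so a translate starts at \<open>c\<close>.\<close>
  obtain \<gamma> where \<gamma>: "\<gamma> \<in> J" "c = cmult X \<gamma> (origin U ((b, e), s))"
  proof (cases s)
    case True
    then show ?thesis using d(2) b Q_edge(1)[OF b(2)] vo_eqD[OF _ c, of b] that
      by (auto simp: origin_def)
  next
    case False
    then show ?thesis
      using d(2) b Q_edge(2)[OF b(2)] vo_eqD[OF _ c, of "extend X b (e, True)"] that
      by (auto simp: origin_def)
  qed
  obtain gs where gs: "\<gamma> = cl gs" "walk X x0 gs x0" using J_loop[OF \<gamma>(1)] .
  have "cmult X \<gamma> b = cl (gs @ xs)" "walk X x0 (gs @ xs) (src X e)"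
    using gs xs by (auto simp: cmult_cl walk_append)
  then have "(cmult X \<gamma> b, e) \<in> edges U" using xs(3) by (auto simp: edges_U)
  moreover have "extend X (cmult X \<gamma> b) (e, True) = cmult X \<gamma> (extend X b (e, True))"
    using extend_cmult[OF \<gamma>(1), of xs "(e, True)"] xs by (simp add: origin_def)
  then have "origin U ((cmult X \<gamma> b, e), s) = c" using \<gamma>(2) by (simp add: origin_def)
  moreover have "omap eo ((cmult X \<gamma> b, e), s) = d"
    using b(1) corbit_shift[OF \<gamma>(1) bU] by (simp add: omap_def)
  ultimately show "\<exists>d'. fst d' \<in> edges U \<and> origin U d' = c \<and> omap eo d' = d"
    by (intro exI[of _ "((cmult X \<gamma> b, e), s)"]) simp
next
  fix d d' assume d: "fst d \<in> edges U" "fst d' \<in> edges U" "origin U d = origin U d'"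
    and eq: "omap eo d = omap eo d'"
  obtain c e s c' e' where [simp]: "d = ((c, e), s)" "d' = ((c', e'), s)"
    using eq by (cases d; cases d') (auto simp: omap_def)
  have "c \<in> verts U" using d(1) unfolding verts_U by (auto simp: edges_U)
  then have "e = e'" using eq corbit_snd by (auto simp: omap_def)
  then show "d = d'"
    using covering.edge_inj[OF covering_U d] by (simp add: omap_def)
next
  fix c y assume c: "c \<in> verts U" and y: "y \<in> faces Q" "origin Q (hd (bnd Q y)) = vo c"
  obtain b \<phi> where b: "y = fo (b, \<phi>)" "(b, \<phi>) \<in> faces U" using y(1) by (auto simp: Q_cells)
  obtain xs where xs: "b = cl xs" "walk X x0 xs (origin X (hd (bnd X \<phi>)))" "\<phi> \<in> faces X"
    using b(2) by (auto simp: faces_U)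
  have bU: "b \<in> verts U" using xs verts_U by blast
  have start: "origin U (hd (bnd U (c', \<phi>))) = c'" "fst (hd (bnd U (c', \<phi>))) \<in> edges U"
    "bnd U (c', \<phi>) \<noteq> []" if "c' = cl zs" "walk X x0 zs (origin X (hd (bnd X \<phi>)))" for c' zs
  proof -
    have ne: "lift X c' (bnd X \<phi>) \<noteq> []"
      using face_walk(2)[OF X xs(3)] by (cases "bnd X \<phi>") auto
    have w: "walk U c' (lift X c' (bnd X \<phi>)) (cl (zs @ bnd X \<phi>))"
      using lift_walk[OF that(2) face_walk(1)[OF X xs(3)]] that(1) by simp
    show "origin U (hd (bnd U (c', \<phi>))) = c'" "fst (hd (bnd U (c', \<phi>))) \<in> edges U"
      "bnd U (c', \<phi>) \<noteq> []"
      using walk_hd[OF w ne] walk_edges[OF w] ne by simp_all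
  qed
  have "vo b = vo c"
    using y(2) start[OF xs(1,2)] by (simp add: b(1) Q_face[OF b(2)] hd_map Q_origin)
  then obtain \<gamma> where \<gamma>: "\<gamma> \<in> J" "c = cmult X \<gamma> b" using vo_eqD[OF _ c, of b] by auto
  obtain gs where gs: "\<gamma> = cl gs" "walk X x0 gs x0" using J_loop[OF \<gamma>(1)] .
  have c': "c = cl (gs @ xs)" "walk X x0 (gs @ xs) (origin X (hd (bnd X \<phi>)))"
    using gs xs \<gamma>(2) by (auto simp: cmult_cl walk_append)
  then have "(c, \<phi>) \<in> faces U" using xs(3) by (auto simp: faces_U)
  moreover have "fo (c, \<phi>) = y" using b(1) \<gamma> corbit_shift[OF \<gamma>(1) bU] by simp
  ultimately show "\<exists>\<phi>' \<in> faces U. fo \<phi>' = y \<and> origin U (hd (bnd U \<phi>')) = c"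
    using start(1)[OF c'] by blast
qed


lemma edge_U_fst: "x \<in> edges U \<Longrightarrow> fst x \<in> verts U"
  and face_U_fst: "y \<in> faces U \<Longrightarrow> fst y \<in> verts U"
proof -
  show "fst x \<in> verts U" if "x \<in> edges U"
    using that unfolding verts_U by (cases x) (auto simp: edges_U)
  show "fst y \<in> verts U" if "y \<in> faces U"
    using that unfolding verts_U by (cases y) (auto simp: faces_U)
qed

lemma endpoint_cmult:
  assumes "\<gamma> \<in> J" "c \<in> verts U"
  shows "endpoint (cmult X \<gamma> c) = endpoint c"
proof -
  obtain gs where gs: "\<gamma> = cl gs" "walk X x0 gs x0" using J_loop[OF assms(1)] .
  obtain xs a where xs: "c = cl xs" "walk X x0 xs a" using assms(2) verts_U by blast
  then have "walk X x0 (gs @ xs) a" using gs by (auto simp: walk_append)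
  then show ?thesis using gs xs by (simp add: cmult_cl endpoint_cl)
qed

text \<open>The map from the quotient to the base. All members of an orbit lie over the same cell,
  so the choice of a member does not matter.\<close>
definition under_v :: "('v, 'e) epath set set \<Rightarrow> 'v" where
  "under_v V = endpoint (SOME c. c \<in> V)"

definition under :: "(('v, 'e) epath set \<times> 'a) set \<Rightarrow> 'a" where
  "under E = snd (SOME x. x \<in> E)"

lemma under_v_vo:
  assumes c: "c \<in> verts U"
  shows "under_v (vo c) = endpoint c"
proof -
  have "endpoint c' = endpoint c" if "c' \<in> vo c" for c'
    using that endpoint_cmult[OF _ c] by (auto simp: vorbit_def)
  then show ?thesis unfolding under_v_def using vo_self[OF c] someI_ex by metis
qed

lemma under_corbit [simp]: "under (corbit X J x) = snd x"
proof -
  have "corbit X J x \<noteq> {}" using one_J by (auto simp: corbit_def)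
  moreover have "snd x' = snd x" if "x' \<in> corbit X J x" for x'
    using that by (auto simp: corbit_def)
  ultimately show ?thesis unfolding under_def by (meson ex_in_conv someI_ex)
qed

lemma covering_base: "covering Q X under_v under under"
  by (rule covering_factor[OF covering_Q covering_U Q_cells]) (simp_all add: under_v_vo)

lemma map_under_eo: "map (omap under) (map (omap eo) ds) = map (omap snd) ds"
  by (simp add: omap_def)

lemma vo_J: "\<gamma> \<in> J \<Longrightarrow> vo \<gamma> = vo v0"
  using vo_shift[OF _ v0_U] cmult_v0_right J_carrier by metis

text \<open>The projection to the quotient of the path in the universal cover that starts at the
  base point and lies over \<open>gs\<close>. It is a cycle if the class of \<open>gs\<close> belongs to \<open>J\<close>.\<close>
definition orbit_loop :: "'e oedge list \<Rightarrow> (('v, 'e) epath set set, (('v, 'e) epath set \<times> 'e) set) epath"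
  where "orbit_loop gs = (vo v0, map (omap eo) (lift X v0 gs))"

lemma map_path_projection: "map_path (projection X J) p = (vo (fst p), map (omap eo) (snd p))"
  by (simp add: map_path_def projection_def map_prod_omap)

lemma orbit_loop_walk:
  assumes "cl gs \<in> J" "walk X x0 gs x0"
  shows "walk Q (vo v0) (map (omap eo) (lift X v0 gs)) (vo v0)"
proof -
  interpret p: covering U Q vo eo fo by (rule covering_Q)
  have "walk U v0 (lift X v0 gs) (cl gs)" using lift_walk[of "[]" x0 gs x0] assms(2) x0 by simp
  then have "walk Q (vo v0) (map (omap eo) (lift X v0 gs)) (vo (cl gs))" by (rule p.walk_map)
  then show ?thesis by (simp add: vo_J[OF assms(1)])
qed

text \<open>A path in the universal cover from the base point to its image under a conjugate
  \<open>h \<gamma> h\<inverse>\<close> projects to a loop which is homotopic to a lift of the conjugate of a loop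
  of \<open>\<gamma>\<close>. As \<open>h\<close> lies in \<open>J\<close>, this lift is itself a conjugate.\<close>

lemma represents_iff:
  assumes gs: "cl gs \<in> J" "walk X x0 gs x0"
  shows "represents X x0 J (conj_class G J (cl gs)) z \<longleftrightarrow> freely_homotopic Q z (orbit_loop gs)"
proof
  interpret G: group G by (rule group_pi1)
  interpret p: covering U Q vo eo fo by (rule covering_Q)
  assume z: "freely_homotopic Q z (orbit_loop gs)"
  then have "is_cycle Q z"
    using freely_homotopic_cycle[OF p.complex(2)] orbit_loop_walk[OF gs]
    by (simp add: orbit_loop_def is_cycle_def)
  moreover have "cl gs \<in> conj_class G J (cl gs)"
    unfolding conj_class_def using J_carrier[OF gs(1)] one_J one_pi1
    by (auto intro!: exI[of _ "\<one>\<^bsub>G\<^esub>"])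
  moreover have "walk U v0 (lift X v0 gs) (cmult X (cl gs) v0)"
    using lift_walk[of "[]" x0 gs x0] gs(2) x0 cmult_v0_right[OF J_carrier[OF gs(1)]] by simp
  ultimately show "represents X x0 J (conj_class G J (cl gs)) z"
    unfolding represents_def Let_def map_path_projection using z
    by (intro conjI bexI[of _ "cl gs"] exI[of _ "(v0, lift X v0 gs)"]) (auto simp: orbit_loop_def)
next
  interpret G: group G by (rule group_pi1)
  interpret p: covering U Q vo eo fo by (rule covering_Q)
  interpret r: covering Q X under_v under under by (rule covering_base)
  assume "represents X x0 J (conj_class G J (cl gs)) z"
  then obtain h p where h: "h \<in> J" and p: "fst p = v0"
    "walk U v0 (snd p) (cmult X (h \<otimes>\<^bsub>G\<^esub> cl gs \<otimes>\<^bsub>G\<^esub> inv\<^bsub>G\<^esub> h) v0)"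
    and z: "freely_homotopic Q z (map_path (projection X J) p)"
    unfolding represents_def conj_class_def Let_def by blast
  obtain hs where hs: "h = cl hs" "walk X x0 hs x0" using J_loop[OF h] .
  note hr = walk_rpath[OF X hs(2)]
  let ?W = "hs @ gs @ rpath hs"
  have W: "walk X x0 ?W x0" using hs(2) gs(2) hr by (auto simp: walk_append)
  have "cmult X (cl (rpath hs)) h = v0"
    using cmult_cl[OF hr hs(2)] hs(1) homotopic_rpath[OF X hr] by (simp add: hclass_eq)
  then have "inv\<^bsub>G\<^esub> h = cl (rpath hs)"
    using hr h J_carrier by (intro G.inv_equality) (auto simp: mult_pi1 one_pi1 carrier_pi1)
  moreover have "walk X x0 (hs @ gs) x0" using hs(2) gs(2) by (auto simp: walk_append)
  ultimately have \<delta>: "h \<otimes>\<^bsub>G\<^esub> cl gs \<otimes>\<^bsub>G\<^esub> inv\<^bsub>G\<^esub> h = cl ?W"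
    using hs gs hr by (simp add: mult_pi1 cmult_cl)
  have \<delta>J: "cl ?W \<in> J"
    using subgroup.m_closed[OF J] subgroup.m_inv_closed[OF J] h gs(1) \<delta> by metis
  have pw: "walk U v0 (snd p) (cl ?W)"
    using p(2) \<delta> cmult_v0_right[OF J_carrier[OF \<delta>J]] by simp
  let ?o = "vo v0" and ?ps = "map (omap snd) (snd p)"
  let ?P = "(?o, map (omap eo) (snd p))"
  have P: "walk Q ?o (map (omap eo) (snd p)) ?o"
    using p.walk_map[OF pw] vo_J[OF \<delta>J] by simp
  have "cl ?W = cl ?ps" using walk_U_end[of "[]", OF pw] x0 by simp
  then have h1: "homotopic X (x0, ?ps) (x0, ?W)" by (simp add: hclass_eq homotopic_sym)
  have "endpoint v0 = x0" using endpoint_cl[of "[]" x0] x0 by simp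
  then have h2: "(x0, ?ps) = r.mp ?P"
    by (simp add: under_v_vo[OF v0_U] map_under_eo del: map_map)
  obtain q where q: "homotopic Q ?P q" "r.mp q = (x0, ?W)"
    using r.homotopic_lift[OF h1 h2] P unfolding is_path_def fst_conv snd_conv by blast
  obtain qs where qs: "q = (?o, qs)" "walk Q ?o qs ?o"
    using homotopic_ends[OF p.complex(2) q(1), of ?o] P by (cases q) auto
  then obtain as bs cs where abc: "qs = as @ bs @ cs" "map (omap under) as = hs"
    "map (omap under) bs = gs" "map (omap under) cs = rpath hs"
    using q(2) by (fastforce simp: map_eq_append_conv append_eq_map_conv)
  obtain a b where w: "walk Q ?o as a" "walk Q a bs b" "walk Q b cs ?o"
    using qs(2) abc(1) by (auto simp: walk_append)
  \<comment> \<open>As \<open>h\<close> and \<open>\<gamma>\<close> lie in \<open>J\<close>, the lifts of \<open>hs\<close> and \<open>gs\<close> at the base vertex are closed.\<close>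
  have "as = map (omap eo) (lift X v0 hs) \<and> a = ?o"
    using r.walk_lift_unique[OF w(1) orbit_loop_walk] h hs abc(2)
    by (simp add: map_under_eo del: map_map)
  then have a: "a = ?o" by simp
  have b: "bs = map (omap eo) (lift X v0 gs) \<and> b = ?o"
    using r.walk_lift_unique[OF w(2)[unfolded a] orbit_loop_walk] gs abc(3)
    by (simp add: map_under_eo del: map_map)
  have "map (omap under) cs = map (omap under) (rpath as)"
    using abc by (simp add: map_omap_rpath)
  then have c: "cs = rpath as"
    using r.walk_lift_unique[OF _ walk_rpath[OF p.complex(2) w(1)]] w(3) a b by blast
  have "freely_homotopic Q q (orbit_loop gs)"
    using freely_homotopic_conjugate[OF p.complex(2), of ?o as ?o bs] w a b c
    by (simp add: qs abc(1) orbit_loop_def)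
  moreover have "freely_homotopic Q ?P q"
    using q(1) P by (intro homotopic_freely_homotopic[OF p.complex(2)]) (simp_all add: is_cycle_def)
  ultimately show "freely_homotopic Q z (orbit_loop gs)"
    using z p(1) freely_homotopic_trans by (simp add: map_path_projection) blast
qed

text \<open>A free homotopy to a constant lifts to the universal cover and ends at a closed walk over
  \<open>gs\<close> that starts at some translate \<open>h\<close> of the base point. That walk ends at \<open>h \<gamma>\<close>, where
  \<open>\<gamma>\<close> is the class of \<open>gs\<close>, so \<open>h \<gamma> = h\<close> and \<open>\<gamma>\<close> is trivial.\<close>
lemma essential_orbit_loop:
  assumes gs: "cl gs \<in> J" "walk X x0 gs x0" and nontrivial: "cl gs \<noteq> \<one>\<^bsub>G\<^esub>"
  shows "essential Q (orbit_loop gs)"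
  unfolding essential_def
proof (intro conjI notI)
  interpret G: group G by (rule group_pi1)
  interpret p: covering U Q vo eo fo by (rule covering_Q)
  show "is_cycle Q (orbit_loop gs)"
    using orbit_loop_walk[OF gs] by (simp add: orbit_loop_def is_cycle_def)
  assume "\<exists>v \<in> verts Q. freely_homotopic Q (orbit_loop gs) (v, [])"
  then obtain c where c: "c \<in> verts U" "freely_homotopic Q (orbit_loop gs) (vo c, [])"
    by (auto simp: Q_cells)
  then obtain q where q: "is_cycle U q" "p.mp q = orbit_loop gs"
    using p.freely_homotopic_lift[OF freely_homotopic_sym[OF c(2)], of "(c, [])"]
    by (auto simp: is_cycle_def)
  obtain d ds where ds: "q = (d, ds)" "walk U d ds d" "vo d = vo v0"
    "map (omap eo) ds = map (omap eo) (lift X v0 gs)"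
    using q by (cases q) (auto simp: is_cycle_def orbit_loop_def)
  have gs': "map (omap snd) ds = gs"
    using arg_cong[OF ds(4), of "map (omap under)"] by (simp add: map_under_eo del: map_map)
  obtain h where h: "h \<in> J" "d = h"
    using vo_eqD[OF ds(3)] walk_startD[OF ds(2)] cmult_v0_right J_carrier by metis
  obtain hs where hs: "h = cl hs" "walk X x0 hs x0" using J_loop[OF h(1)] .
  have "cl hs = cl (hs @ gs)" using walk_U_end[of hs ds d x0] ds(2) h hs gs' by simp
  then have "h \<otimes>\<^bsub>G\<^esub> cl gs = h"
    unfolding hs(1) mult_pi1 cmult_cl[OF hs(2) gs(2)] by (rule sym)
  then have "cl gs = \<one>\<^bsub>G\<^esub>"
    using J_carrier[OF h(1)] J_carrier[OF gs(1)] by (simp add: G.l_cancel_one')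
  with nontrivial show False by simp
qed

lemma subgroup_nontrivial:
  assumes "J \<noteq> {\<one>\<^bsub>G\<^esub>}"
  obtains gs where "cl gs \<in> J" "walk X x0 gs x0" "cl gs \<noteq> \<one>\<^bsub>G\<^esub>"
  using assms one_J J_loop unfolding one_pi1 by (metis insertI1 insert_absorb subsetI subset_singletonD empty_iff)

lemma core_vertex:
  assumes "J \<noteq> {\<one>\<^bsub>G\<^esub>}"
  shows "\<exists>v \<in> verts Q. Vert v \<in> core_cells Q"
proof -
  interpret p: covering U Q vo eo fo by (rule covering_Q)
  obtain gs where gs: "cl gs \<in> J" "walk X x0 gs x0" "cl gs \<noteq> \<one>\<^bsub>G\<^esub>"
    using subgroup_nontrivial[OF assms] .
  note e = essential_orbit_loop[OF gs]
  obtain z where z: "freely_homotopic Q (orbit_loop gs) z" "path_cells Q z \<subseteq> core_skeleton Q"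
    using essential_homotopic_shortest[OF p.complex(2) e] .
  have "is_cycle Q z"
    using freely_homotopic_cycle[OF p.complex(2) z(1)] e by (simp add: essential_def)
  then have "fst z \<in> verts Q" unfolding is_cycle_def by (rule walk_startD)
  moreover have "Vert (fst z) \<in> path_cells Q z" by (simp add: path_cells_def)
  ultimately show ?thesis using z(2) unfolding core_cells_def by blast
qed

text \<open>The representatives of the class of \<open>\<gamma>\<close> form a whole free homotopy class, so
  shortest among them means shortest in the sense of the core skeleton.\<close>
lemma shortest_rep_core:
  assumes gs: "cl gs \<in> J" "walk X x0 gs x0" "cl gs \<noteq> \<one>\<^bsub>G\<^esub>"
    and z: "shortest_rep X x0 J (conj_class G J (cl gs)) z"
  shows "path_cells Q z \<subseteq> core_cells Q"
proof -
  interpret p: covering U Q vo eo fo by (rule covering_Q)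
  have h: "freely_homotopic Q z (orbit_loop gs)"
    and m: "\<And>z'. freely_homotopic Q z' (orbit_loop gs) \<Longrightarrow> path_length z \<le> path_length z'"
    using z unfolding shortest_rep_def represents_iff[OF gs(1,2)] by blast+
  have "essential Q z"
    using essential_orbit_loop[OF gs] h freely_homotopic_cycle[OF p.complex(2) h]
      freely_homotopic_trans[OF freely_homotopic_sym[OF h]] unfolding essential_def by blast
  moreover have "\<forall>z'. is_cycle Q z' \<and> freely_homotopic Q z z' \<longrightarrow> path_length z \<le> path_length z'"
    using m freely_homotopic_trans[OF freely_homotopic_sym h] by blast
  ultimately show ?thesis unfolding core_cells_def core_skeleton_def by blast
qed

end


section \<open>Natural morphisms between quotients\<close>

locale quotient_pair =
  A: quotient_complex X x0 J1 + B: quotient_complex X x0 J2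
  for X :: "('v, 'e, 'f, 'l) complex2" and x0 :: 'v and J1 J2 :: "('v, 'e) epath set set" +
  assumes sub: "J1 \<subseteq> J2"
begin

abbreviation "nv \<equiv> \<lambda>V. \<Union> (vorbit X J2 ` V)"
abbreviation "nc \<equiv> \<lambda>E. \<Union> (corbit X J2 ` E)"

lemma nv_orbit:
  assumes "c \<in> verts (ucover X x0)"
  shows "nv (vorbit X J1 c) = vorbit X J2 c"
proof (rule SUP_eq_const)
  show "vorbit X J1 c \<noteq> {}" using A.vo_self[OF assms] by blast
  fix c' assume "c' \<in> vorbit X J1 c"
  then obtain \<gamma> where "\<gamma> \<in> J1" "c' = cmult X \<gamma> c" by (auto simp: vorbit_def)
  then show "vorbit X J2 c' = vorbit X J2 c" using B.vo_shift[OF _ assms] sub by blast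
qed

lemma nc_orbit:
  assumes "fst x \<in> verts (ucover X x0)"
  shows "nc (corbit X J1 x) = corbit X J2 x"
proof (rule SUP_eq_const)
  show "corbit X J1 x \<noteq> {}" using A.one_J by (auto simp: corbit_def)
  fix y assume "y \<in> corbit X J1 x"
  then obtain \<gamma> where "\<gamma> \<in> J1" "y = (cmult X \<gamma> (fst x), snd x)" by (auto simp: corbit_def)
  then show "corbit X J2 y = corbit X J2 x"
    using B.corbit_shift[of \<gamma> "fst x" "snd x"] assms sub by auto
qed

lemma covering_natural: "covering A.Q B.Q nv nc nc"
  by (rule covering_factor[OF A.covering_Q B.covering_Q A.Q_cells])
    (simp_all only: nv_orbit nc_orbit A.edge_U_fst A.face_U_fst)

sublocale covering A.Q B.Q nv nc nc
  by (rule covering_natural)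

lemma natural_map_eq: "natural_map X J2 = (nv, nc, nc)"
  by (simp add: natural_map_def)

lemma orbit_loop_natural:
  assumes "walk X x0 gs x0"
  shows "mp (A.orbit_loop gs) = B.orbit_loop gs"
proof -
  have w: "walk A.U A.v0 (lift X A.v0 gs) (A.cl gs)"
    using A.lift_walk[of "[]" x0 gs x0] assms A.x0 by simp
  have "omap nc (omap (corbit X J1) d) = omap (corbit X J2) d" if "d \<in> set (lift X A.v0 gs)" for d
    using nc_orbit[OF A.edge_U_fst[OF walk_edges[OF w that]]] by (simp add: omap_def)
  then show ?thesis
    using nv_orbit[OF A.v0_U] by (simp add: A.orbit_loop_def B.orbit_loop_def)
qed

text \<open>The free homotopy from a shortest cycle downstairs to the projection of a path from the
  base point to its \<open>\<gamma>\<close>-translate lifts, and the projection upstairs of this path represents the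
  class of \<open>\<gamma>\<close>. The end of the lifted homotopy is shortest because the natural morphism
  preserves lengths.\<close>

lemma shortest_rep_lift:
  assumes gs: "A.cl gs \<in> J1" "walk X x0 gs x0"
    and z: "shortest_rep X x0 J2 (conj_class A.G J2 (A.cl gs)) z2"
  obtains z1 where "shortest_rep X x0 J1 (conj_class A.G J1 (A.cl gs)) z1" "mp z1 = z2"
proof -
  have gs2: "A.cl gs \<in> J2" using gs(1) sub by blast
  note iff1 = A.represents_iff[OF gs] and iff2 = B.represents_iff[OF gs2 gs(2)]
  have z2: "freely_homotopic B.Q z2 (B.orbit_loop gs)"
    and m: "\<And>z'. freely_homotopic B.Q z' (B.orbit_loop gs) \<Longrightarrow> path_length z2 \<le> path_length z'"
    using z unfolding shortest_rep_def iff2 by blast+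
  have "is_cycle A.Q (A.orbit_loop gs)"
    using A.orbit_loop_walk[OF gs] by (simp add: A.orbit_loop_def is_cycle_def)
  then obtain z1 where z1: "freely_homotopic A.Q (A.orbit_loop gs) z1" "mp z1 = z2"
    using freely_homotopic_lift[OF freely_homotopic_sym[OF z2]] orbit_loop_natural[OF gs(2)]
    by metis
  have "path_length z1 \<le> path_length z'" if "freely_homotopic A.Q z' (A.orbit_loop gs)" for z'
  proof -
    have "freely_homotopic B.Q (mp z') (B.orbit_loop gs)"
      using freely_homotopic_map[OF that] orbit_loop_natural[OF gs(2)] by simp
    from m[OF this] show ?thesis using mp_simps(4)[of z1] mp_simps(4)[of z'] z1(2) by simp
  qed
  then have "shortest_rep X x0 J1 (conj_class A.G J1 (A.cl gs)) z1"
    unfolding shortest_rep_def iff1 using freely_homotopic_sym[OF z1(1)] by blast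
  with z1(2) that show ?thesis by blast
qed

text \<open>For the trivial group, whose core is a vertex that may be chosen above a given one.\<close>
lemma vertex_morphism:
  assumes "is_complex (subcomplex B.Q C)" "v \<in> verts B.Q" "Vert v \<in> C"
  obtains u where "u \<in> verts A.Q"
    "morphism (subcomplex A.Q {Vert u}) (subcomplex B.Q C) (natural_map X J2)"
proof -
  obtain c where c: "c \<in> verts A.U" "v = vorbit X J2 c"
    using assms(2) by (auto simp: B.Q_cells)
  have "is_complex (subcomplex A.Q {Vert (vorbit X J1 c)})"
    by (rule subcomplex_complex[OF complex(1)]) simp
  then have "morphism (subcomplex A.Q {Vert (vorbit X J1 c)}) (subcomplex B.Q C) (nv, nc, nc)"
    using assms(1,3) c nv_orbit by (intro morphism_restrict) auto
  moreover have "vorbit X J1 c \<in> verts A.Q" using c(1) by (simp add: A.Q_cells)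
  ultimately show ?thesis using that natural_map_eq by metis
qed

end


section \<open>Core surfaces\<close>

lemma surface_complex:
  assumes "g \<ge> 1"
  shows "is_complex (surface g)"
proof -
  have "walk (surface g) () ds ()" if "fst ` set ds \<subseteq> edges (surface g)" for ds
    using that by (induction ds) (auto simp: surface_def)
  moreover have "fst ` set (bnd (surface g) ()) \<subseteq> edges (surface g)"
    by (auto simp: surface_def)
  moreover have "bnd (surface g) () \<noteq> []"
    using assms by (auto simp: surface_def)
  ultimately show ?thesis by (simp add: is_complex_def is_cycle_def) (simp add: surface_def)
qed

theorem lemma5p4:
  fixes g :: nat and J1 J2 :: "surf_elt set"
  assumes "g \<ge> 2"
    and "subgroup J1 (surface_group g)" and "subgroup J2 (surface_group g)" and "J1 \<subseteq> J2"
  shows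
    "(\<forall>C2. is_core g J2 C2 \<longrightarrow>
        (\<exists>C1. is_core g J1 C1 \<and>
              morphism (subcomplex (cover g J1) C1) (subcomplex (cover g J2) C2)
                       (natural_morphism g J2)))
     \<and>
     (\<forall>C1 C2. is_core g J1 C1 \<longrightarrow> is_core g J2 C2 \<longrightarrow>
        (\<forall>\<gamma> \<in> J1. \<gamma> \<noteq> \<one>\<^bsub>surface_group g\<^esub> \<longrightarrow>
           (\<forall>z2. shortest_cycle_of g J2 \<gamma> z2 \<and> path_cells (cover g J2) z2 \<subseteq> C2 \<longrightarrow>
              (\<exists>z1. shortest_cycle_of g J1 \<gamma> z1 \<and> path_cells (cover g J1) z1 \<subseteq> C1 \<and>
                    z2 = map_path (natural_morphism g J2) z1))))"
proof -
  have "pointed_complex (surface g) ()"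
    using assms(1) surface_complex[of g] by unfold_locales (auto simp: surface_def)
  then interpret quotient_pair "surface g" "()" J1 J2
    using assms unfolding surface_group_def
    by (intro quotient_pair.intro quotient_complex.intro quotient_complex_axioms.intro
        quotient_pair_axioms.intro)
  note defs = is_core_def cover_def natural_morphism_def shortest_cycle_of_def surface_group_def
  have nontrivial: "J2 \<noteq> {\<one>\<^bsub>A.G\<^esub>}" if "J1 \<noteq> {\<one>\<^bsub>A.G\<^esub>}"
    using that A.one_J sub A.one_pi1 by auto
  have "\<exists>C1. is_core g J1 C1 \<and>
      morphism (subcomplex (cover g J1) C1) (subcomplex (cover g J2) C2) (natural_morphism g J2)"
    if C2: "is_core g J2 C2" for C2
  proof (cases "J1 = {\<one>\<^bsub>A.G\<^esub>}")
    case True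
    have "\<exists>v \<in> verts B.Q. Vert v \<in> C2"
      using C2 B.core_vertex by (auto simp: defs split: if_splits)
    moreover have "is_complex (subcomplex B.Q C2)"
      using C2 core_cells_closed[OF complex(2)] complex(2)
      by (intro subcomplex_complex) (auto simp: defs split: if_splits)
    ultimately obtain u where "u \<in> verts A.Q"
      "morphism (subcomplex A.Q {Vert u}) (subcomplex B.Q C2) (natural_map (surface g) J2)"
      using vertex_morphism by blast
    then show ?thesis using True by (auto simp: defs)
  next
    case False
    then have "C2 = core_cells B.Q" using C2 nontrivial by (simp add: defs)
    then show ?thesis
      using False core_morphism by (auto simp: defs natural_map_eq)
  qed
  moreover have "\<exists>z1. shortest_cycle_of g J1 \<gamma> z1 \<and> path_cells (cover g J1) z1 \<subseteq> C1 \<and>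
      z2 = map_path (natural_morphism g J2) z1"
    if C1: "is_core g J1 C1" and \<gamma>: "\<gamma> \<in> J1" "\<gamma> \<noteq> \<one>\<^bsub>surface_group g\<^esub>"
      and z2: "shortest_cycle_of g J2 \<gamma> z2" for C1 \<gamma> z2
  proof -
    obtain gs where gs: "\<gamma> = A.cl gs" "walk (surface g) () gs ()" using A.J_loop[OF \<gamma>(1)] .
    have "C1 = core_cells A.Q" using C1 \<gamma> by (auto simp: defs split: if_splits)
    moreover obtain z1 where z1: "shortest_rep (surface g) () J1 (conj_class A.G J1 (A.cl gs)) z1"
      "mp z1 = z2"
      using shortest_rep_lift[of gs z2] gs \<gamma>(1) z2 by (auto simp: defs)
    moreover have "path_cells A.Q z1 \<subseteq> core_cells A.Q"
      using A.shortest_rep_core[OF _ gs(2) _ z1(1)] gs(1) \<gamma> by (simp add: defs)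
    ultimately show ?thesis
      using gs(1) by (intro exI[of _ z1]) (simp add: defs natural_map_eq)
  qed
  ultimately show ?thesis by blast
qed

end
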